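(* Let $F$ be a Boolean formula of size $s$ computing a Boolean function $g$ on $n$ inputs (distributed in any way between Alice and Bob), built from gates $\wedge,\vee,\oplus$ of arbitrary fan-in and additionally Majority gates of arbitrary fan-in, such that every path from the root to a leaf contains at most $O(1)$ Majority gates. Then for every constant $\epsilon>0$, $GH(g)\le O(s^{1+\epsilon})$.
   Context: A Boolean formula is a Boolean circuit in which every gate has fan-out 1 (a tree); its size is its number of leaves. A Majority gate of fan-in $m$ outputs 1 iff at least $m/2$ of its inputs are 1. Garden-hose model: Alice holds her input $x$, Bob holds $y$. A garden-hose protocol of size $s$ consists of a set $V$ of $s$ vertices (pipes) and an extra vertex $t$ (the tap), together with an assignment of a matching $E_A(x)$ on $V\cup\{t\}$ to every input $x$ of Alice and a matching $E_B(y)$ on $V$ to every input $y$ of Bob. In the graph $(V\cup\{t\},E_A(x)\cup E_B(y))$ every vertex has degree at most 2, so there is a unique maximal path starting at $t$; the output on $(x,y)$ is the parity of the number of edges of this path. The protocol computes $g$ if the output equals $g$ for all inputs. $GH(g)$ is the minimum size of a garden-hose protocol computing $g$. *)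

theory Defs
  imports
    Complex_Main
    "HOL-Library.FuncSet"
    "HOL-Library.Extended_Nat"
    "HOL-Library.Extended_Real"
begin

section \<open>Boolean formulas\<close>

datatype bform =
    Const bool
  | Var nat
  | NegVar nat
  | And "bform list"
  | Or "bform list"
  | Xor "bform list"
  | Maj "bform list"

fun eval :: "(nat \<Rightarrow> bool) \<Rightarrow> bform \<Rightarrow> bool" where
  "eval z (Const b) = b"
| "eval z (Var i) = z i"
| "eval z (NegVar i) = (\<not> z i)"
| "eval z (And Fs) = (\<forall>F\<in>set Fs. eval z F)"
| "eval z (Or Fs) = (\<exists>F\<in>set Fs. eval z F)"
| "eval z (Xor Fs) = odd (length (filter (eval z) Fs))"
| "eval z (Maj Fs) = (real (length (filter (eval z) Fs)) \<ge> real (length Fs) / 2)"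

text \<open>Gates have fan-in at least 1, so that the leaves of the tree are exactly its
  constants and literals.\<close>

fun formula_on :: "nat \<Rightarrow> bform \<Rightarrow> bool" where
  "formula_on n (Const b) = True"
| "formula_on n (Var i) = (i < n)"
| "formula_on n (NegVar i) = (i < n)"
| "formula_on n (And Fs) = (Fs \<noteq> [] \<and> (\<forall>F\<in>set Fs. formula_on n F))"
| "formula_on n (Or Fs) = (Fs \<noteq> [] \<and> (\<forall>F\<in>set Fs. formula_on n F))"
| "formula_on n (Xor Fs) = (Fs \<noteq> [] \<and> (\<forall>F\<in>set Fs. formula_on n F))"
| "formula_on n (Maj Fs) = (Fs \<noteq> [] \<and> (\<forall>F\<in>set Fs. formula_on n F))"

fun leaves :: "bform \<Rightarrow> nat" where
  "leaves (Const b) = 1"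
| "leaves (Var i) = 1"
| "leaves (NegVar i) = 1"
| "leaves (And Fs) = (\<Sum>F\<leftarrow>Fs. leaves F)"
| "leaves (Or Fs) = (\<Sum>F\<leftarrow>Fs. leaves F)"
| "leaves (Xor Fs) = (\<Sum>F\<leftarrow>Fs. leaves F)"
| "leaves (Maj Fs) = (\<Sum>F\<leftarrow>Fs. leaves F)"

text \<open>The maximal number of Majority gates on a path from the root to a leaf.\<close>

fun maj_depth :: "bform \<Rightarrow> nat" where
  "maj_depth (Const b) = 0"
| "maj_depth (Var i) = 0"
| "maj_depth (NegVar i) = 0"
| "maj_depth (And Fs) = Max (maj_depth ` set Fs)"
| "maj_depth (Or Fs) = Max (maj_depth ` set Fs)"
| "maj_depth (Xor Fs) = Max (maj_depth ` set Fs)"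
| "maj_depth (Maj Fs) = Suc (Max (maj_depth ` set Fs))"

text \<open>Assignments of bits to the variables with indices in \<open>I\<close>.\<close>

definition cube :: "nat set \<Rightarrow> (nat \<Rightarrow> bool) set" where
  "cube I = I \<rightarrow>\<^sub>E UNIV"

definition formula_computes :: "nat \<Rightarrow> bform \<Rightarrow> ((nat \<Rightarrow> bool) \<Rightarrow> bool) \<Rightarrow> bool" where
  "formula_computes n F g \<longleftrightarrow> (\<forall>z\<in>cube {..<n}. eval z F = g z)"

text \<open>The two-party function in which Alice holds the variables in \<open>A\<close> and Bob the others.\<close>

definition split_fun ::
    "nat set \<Rightarrow> ((nat \<Rightarrow> bool) \<Rightarrow> bool) \<Rightarrow> (nat \<Rightarrow> bool) \<Rightarrow> (nat \<Rightarrow> bool) \<Rightarrow> bool" where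
  "split_fun A g x y = g (override_on y x A)"

lemma override_on_cube:
  assumes "A \<subseteq> {..<n}" "x \<in> cube A" "y \<in> cube ({..<n} - A)"
  shows "override_on y x A \<in> cube {..<n}"
  using assms by (auto simp: cube_def PiE_def extensional_def override_on_def)


section \<open>The garden-hose model\<close>

definition matching_on :: "'v set \<Rightarrow> 'v set set \<Rightarrow> bool" where
  "matching_on W E \<longleftrightarrow> (\<forall>e\<in>E. e \<subseteq> W \<and> card e = 2) \<and> pairwise disjnt E"

definition path_from :: "'v set set \<Rightarrow> 'v \<Rightarrow> 'v list \<Rightarrow> bool" where
  "path_from E t p \<longleftrightarrow>
     p \<noteq> [] \<and> hd p = t \<and> distinct p \<and> successively (\<lambda>u v. {u, v} \<in> E) p"

definition maximal_path_from :: "'v set set \<Rightarrow> 'v \<Rightarrow> 'v list \<Rightarrow> bool" where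
  "maximal_path_from E t p \<longleftrightarrow> path_from E t p \<and> (\<nexists>v. path_from E t (p @ [v]))"

text \<open>A path given by its list \<open>p\<close> of vertices has \<open>length p - 1\<close> edges.\<close>

definition gh_output :: "'v set set \<Rightarrow> 'v \<Rightarrow> bool" where
  "gh_output E t \<longleftrightarrow> odd (length (THE p. maximal_path_from E t p) - 1)"

text \<open>The sets \<open>X\<close> and \<open>Y\<close> are the input domains of Alice and Bob.  Taking the vertices
  to be natural numbers is no restriction, since vertex sets are finite.\<close>

definition gh_protocol ::
    "'a set \<Rightarrow> 'b set \<Rightarrow> nat set \<Rightarrow> nat \<Rightarrow> ('a \<Rightarrow> nat set set) \<Rightarrow> ('b \<Rightarrow> nat set set) \<Rightarrow> bool" where
  "gh_protocol X Y V t EA EB \<longleftrightarrow>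
     finite V \<and> t \<notin> V \<and>
     (\<forall>x\<in>X. matching_on (insert t V) (EA x)) \<and>
     (\<forall>y\<in>Y. matching_on V (EB y))"

definition gh_computes ::
    "'a set \<Rightarrow> 'b set \<Rightarrow> nat \<Rightarrow> ('a \<Rightarrow> nat set set) \<Rightarrow> ('b \<Rightarrow> nat set set) \<Rightarrow>
     ('a \<Rightarrow> 'b \<Rightarrow> bool) \<Rightarrow> bool" where
  "gh_computes X Y t EA EB f \<longleftrightarrow> (\<forall>x\<in>X. \<forall>y\<in>Y. gh_output (EA x \<union> EB y) t = f x y)"

text \<open>The infimum is taken in \<^typ>\<open>enat\<close>, so it would be \<open>\<infinity>\<close>, rather than a junk value, if no
  protocol computed \<open>f\<close>; otherwise it is a minimum.\<close>

definition GH :: "'a set \<Rightarrow> 'b set \<Rightarrow> ('a \<Rightarrow> 'b \<Rightarrow> bool) \<Rightarrow> enat" where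
  "GH X Y f =
     Inf {enat (card V) | V t EA EB. gh_protocol X Y V t EA EB \<and> gh_computes X Y t EA EB f}"

text \<open>For every protocol and every input the maximal path from the tap exists and is unique.\<close>

lemma matching_on_unique:
  assumes "matching_on W E" "{u, v} \<in> E" "{u, w} \<in> E"
  shows "v = w"
proof -
  have "\<not> disjnt {u, v} {u, w}" by (simp add: disjnt_def)
  then have "{u, v} = {u, w}"
    using assms unfolding matching_on_def by (auto dest: pairwiseD)
  then show ?thesis by (auto simp: doubleton_eq_iff)
qed

lemma path_from_snoc:
  "path_from E t (p @ [v]) \<longleftrightarrow>
     (if p = [] then v = t else path_from E t p \<and> v \<notin> set p \<and> {last p, v} \<in> E)"
  by (cases "p = []") (auto simp: path_from_def successively_append_iff hd_append)

lemma path_from_take: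
  assumes "path_from E t q" "0 < n"
  shows "path_from E t (take n q)"
proof -
  have "successively (\<lambda>u v. {u, v} \<in> E) (take n q)"
    using assms(1) successively_append_iff[of "\<lambda>u v. {u, v} \<in> E" "take n q" "drop n q"]
    unfolding path_from_def by simp
  then show ?thesis using assms by (simp add: path_from_def)
qed

lemma path_from_prefix:
  assumes A: "matching_on (insert t V) A" and B: "matching_on V B" and t: "t \<notin> V"
    and "path_from (A \<union> B) t p" "path_from (A \<union> B) t q" "length p \<le> length q"
  shows "p = take (length p) q"
  using assms(4-6)
proof (induction p rule: rev_induct)
  case Nil
  then show ?case by simp
next
  case (snoc v p)
  show ?case
  proof (cases "p = []")
    case True
    then show ?thesis using snoc.prems by (cases q) (simp_all add: path_from_def)
  next
    case False
    have p: "path_from (A \<union> B) t p" and v: "v \<notin> set p" and uv: "{last p, v} \<in> A \<union> B"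
      using snoc.prems(1) False unfolding path_from_snoc by simp_all
    have len: "length p < length q" using snoc.prems(3) by simp
    have pq: "p = take (length p) q"
      using snoc.IH[OF p snoc.prems(2)] len by simp
    define w where "w = q ! length p"
    have pw: "take (Suc (length p)) q = p @ [w]"
      using take_Suc_conv_app_nth[OF len] pq w_def by simp
    then have "path_from (A \<union> B) t (p @ [w])"
      using path_from_take[OF snoc.prems(2), of "Suc (length p)"] by simp
    then have w: "w \<notin> set p" and uw: "{last p, w} \<in> A \<union> B"
      using False unfolding path_from_snoc by simp_all
    obtain p' u where p': "p = p' @ [u]" using False by (cases p rule: rev_cases) simp_all
    have "v = w"
    proof (cases "p' = []")
      case True
      then have "last p = t" using p p' by (simp add: path_from_def)
      then have "{last p, v} \<in> A" "{last p, w} \<in> A"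
        using uv uw B t unfolding matching_on_def by auto
      then have "{t, v} \<in> A" "{t, w} \<in> A" using \<open>last p = t\<close> by simp_all
      then show ?thesis by (rule matching_on_unique[OF A])
    next
      case False
      have "{last p', u} \<in> A \<union> B"
        using p False unfolding p' path_from_snoc by simp
      then have ua: "{last p, last p'} \<in> A \<union> B"
        using p' by (simp add: insert_commute)
      have "last p' \<in> set p" using False p' by simp
      then have "last p' \<noteq> v" "last p' \<noteq> w" using v w by blast+
      then show ?thesis
        using uv uw ua matching_on_unique[OF A, of "last p"] matching_on_unique[OF B, of "last p"]
        by (metis Un_iff)
    qed
    then show ?thesis using pw by simp
  qed
qed

lemma path_from_vertices:
  assumes "matching_on (insert t V) A" "matching_on V B" "path_from (A \<union> B) t p"
  shows "set p \<subseteq> insert t V"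
  using assms(3)
proof (induction p rule: rev_induct)
  case (snoc v p)
  show ?case
  proof (cases "p = []")
    case True
    then show ?thesis using snoc.prems by (simp add: path_from_def)
  next
    case False
    then have "path_from (A \<union> B) t p" "{last p, v} \<in> A \<union> B"
      using snoc.prems unfolding path_from_snoc by simp_all
    then show ?thesis
      using snoc.IH assms(1,2) unfolding matching_on_def by auto
  qed
qed simp

lemma ex1_maximal_path_from:
  assumes A: "matching_on (insert t V) A" and B: "matching_on V B" and t: "t \<notin> V"
    and fin: "finite V"
  shows "\<exists>!p. maximal_path_from (A \<union> B) t p"
proof -
  let ?P = "path_from (A \<union> B) t"
  have uniq: "p = q" if p: "maximal_path_from (A \<union> B) t p" and q: "maximal_path_from (A \<union> B) t q"
      and le: "length p \<le> length q" for p q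
  proof -
    have P: "?P p" "?P q" using p q unfolding maximal_path_from_def by blast+
    have pq: "p = take (length p) q"
      by (rule path_from_prefix[OF A B t P le])
    have "\<not> length p < length q"
    proof
      assume l: "length p < length q"
      have "?P (take (Suc (length p)) q)"
        using P(2) by (rule path_from_take) simp
      then have "?P (p @ [q ! length p])"
        using take_Suc_conv_app_nth[OF l] pq by simp
      then show False using p unfolding maximal_path_from_def by blast
    qed
    then show ?thesis using pq le by simp
  qed
  have len: "length p \<le> card (insert t V)" if "?P p" for p
  proof -
    have "card (set p) \<le> card (insert t V)"
      using path_from_vertices[OF A B that] fin by (intro card_mono) simp_all
    then show ?thesis using that by (simp add: path_from_def distinct_card)
  qed
  have "?P [t]" by (simp add: path_from_def)
  moreover have "\<forall>p. ?P p \<longrightarrow> length p < Suc (card (insert t V))" using len by (simp add: less_Suc_eq_le del: card_insert_disjoint)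
  ultimately have "\<exists>p. ?P p \<and> (\<forall>q. ?P q \<longrightarrow> length q \<le> length p)"
    by (rule ex_has_greatest_nat[of ?P "[t]" length "Suc (card (insert t V))"])
  then obtain p where p: "?P p" "\<And>q. ?P q \<Longrightarrow> length q \<le> length p" by auto
  have "\<not> ?P (p @ [v])" for v
    using p(2)[of "p @ [v]"] by auto
  then have max: "maximal_path_from (A \<union> B) t p"
    using p(1) unfolding maximal_path_from_def by blast
  have "q = p" if q: "maximal_path_from (A \<union> B) t q" for q
  proof (cases "length p \<le> length q")
    case True
    then show ?thesis using uniq[OF max q] by simp
  next
    case False
    then show ?thesis using uniq[OF q max] by simp
  qed
  with max show ?thesis by (rule ex1I)
qed

end

theory Submission
  imports Defs
begin

text \<open>
  A layered program of width \<open>N\<close> and length \<open>L\<close>, in which every step permutes \<open>N\<close> states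
  depending on one player's input, is a garden-hose protocol with \<open>O(N L)\<close> pipes, so it
  suffices to find programs of width \<open>s\<^sup>\<epsilon>\<close> and length \<open>s\<^bsup>1+\<epsilon>\<^esup>\<close>.

  For formulas over \<open>\<and>\<close>, \<open>\<oplus>\<close> and constants, the program acts on boundedly many registers over
  GF(2) by instructions \<open>r\<^sub>b += r\<^sub>a * l\<close> that work for arbitrary initial register contents, in
  the style of Ben-Or and Cleve. A formula with \<open>O(K)\<close> leaves is evaluated by using each leaf
  only four times, whatever \<open>K\<close> is. An arbitrary formula of size \<open>s\<close> is cut into \<open>O(K)\<close> pieces
  of size \<open>O(s / K)\<close> and total size \<open>O(s)\<close> below such a skeleton, and \<open>K\<close> large turns the
  constant loss per level of recursion into a factor \<open>s\<^sup>\<epsilon>\<close>.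

  A Majority gate of fan-in \<open>m\<close> asks for the sign of \<open>y = 2c - m\<close>, where \<open>c\<close> is the number of
  true inputs. The residues of \<open>y\<close> modulo a bounded number of coprime moduli of size about
  \<open>m\<^sup>\<epsilon>\<close> are computed one at a time and added up to an approximation of \<open>y / M\<close> modulo 1, where
  \<open>M\<close> is the product of the moduli. If this approximation is too close to 0 to show the sign,
  then \<open>\<bar>y\<bar>\<close> is small and one modulus can be dropped.
\<close>

section \<open>Permutation programs\<close>

type_synonym input = "nat \<Rightarrow> bool"
type_synonym 's step = "input \<Rightarrow> 's \<Rightarrow> 's"

definition depends_on :: "nat set \<Rightarrow> (input \<Rightarrow> 'b) \<Rightarrow> bool" where
  "depends_on A h \<longleftrightarrow> (\<forall>z z'. (\<forall>i\<in>A. z i = z' i) \<longrightarrow> h z = h z')"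

text \<open>Bijectivity on all of \<open>S\<close> and for every input is what later makes the edges
  of each player a matching, also at states that the actual run never visits.\<close>

definition local_step :: "nat set \<Rightarrow> 's set \<Rightarrow> 's step \<Rightarrow> bool" where
  "local_step A S \<sigma> \<longleftrightarrow>
     (\<forall>z. bij_betw (\<sigma> z) S S) \<and> (depends_on A \<sigma> \<or> depends_on (- A) \<sigma>)"

definition program :: "nat set \<Rightarrow> 's set \<Rightarrow> 's step list \<Rightarrow> bool" where
  "program A S ps \<longleftrightarrow> (\<forall>\<sigma>\<in>set ps. local_step A S \<sigma>)"

fun run :: "'s step list \<Rightarrow> input \<Rightarrow> 's \<Rightarrow> 's" where
  "run [] z s = s"
| "run (\<sigma> # ps) z s = run ps z (\<sigma> z s)"

text \<open>The bit is stored in the states 0 and 1, and the program adds \<open>f z\<close> to it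
  instead of overwriting it. A second run therefore removes what the first one added. Nothing is
  said about where the other states go.\<close>

definition computes :: "nat set \<Rightarrow> nat \<Rightarrow> nat \<Rightarrow> (input \<Rightarrow> bool) \<Rightarrow> bool" where
  "computes A N L f \<longleftrightarrow> 2 \<le> N \<and> (\<exists>ps. program A {..<N} ps \<and> length ps \<le> L \<and>
     (\<forall>z b. run ps z (of_bool b) = of_bool (b \<noteq> f z)))"

lemma depends_on_comp: "depends_on A h \<Longrightarrow> depends_on A (\<lambda>z. G (h z))"
  unfolding depends_on_def by metis

lemma local_step_map:
  assumes "local_step A S \<sigma>" "\<And>\<pi>. bij_betw \<pi> S S \<Longrightarrow> bij_betw (G \<pi>) T T"
  shows "local_step A T (\<lambda>z. G (\<sigma> z))"
  using assms depends_on_comp[of _ \<sigma> G] unfolding local_step_def by blast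

lemma local_step_mem: "local_step A S \<sigma> \<Longrightarrow> s \<in> S \<Longrightarrow> \<sigma> z s \<in> S"
  unfolding local_step_def by (meson bij_betw_apply)

lemma local_step_const: "bij_betw \<pi> S S \<Longrightarrow> local_step A S (\<lambda>z. \<pi>)"
  unfolding local_step_def depends_on_def by simp

lemma program_simps [simp]:
  "program A S []"
  "program A S (\<sigma> # ps) \<longleftrightarrow> local_step A S \<sigma> \<and> program A S ps"
  "program A S (ps @ qs) \<longleftrightarrow> program A S ps \<and> program A S qs"
  unfolding program_def by auto

lemma run_append [simp]: "run (ps @ qs) z s = run qs z (run ps z s)"
  by (induction ps arbitrary: s) auto

text \<open>The inverse of a step reads the same player's input as the step itself, so undoing a
  program takes no more steps than running it.\<close>

lemma program_inverse:
  assumes "program A S ps"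
  shows "\<exists>qs. program A S qs \<and> length qs = length ps \<and> (\<forall>z. \<forall>s\<in>S. run qs z (run ps z s) = s)"
  using assms
proof (induction ps)
  case (Cons \<sigma> ps)
  then obtain qs where qs: "program A S qs" "length qs = length ps"
    "\<forall>z. \<forall>s\<in>S. run qs z (run ps z s) = s" by auto
  have \<sigma>: "local_step A S \<sigma>" using Cons.prems by simp
  have b: "bij_betw (\<sigma> z) S S" for z using \<sigma> unfolding local_step_def by blast
  let ?\<tau> = "\<lambda>z. inv_into S (\<sigma> z)"
  have "local_step A S ?\<tau>" by (rule local_step_map[OF \<sigma>]) (rule bij_betw_inv_into)
  moreover have "run (qs @ [?\<tau>]) z (run (\<sigma> # ps) z s) = s" if "s \<in> S" for z s
    using that qs(3) b[of z] by (simp add: bij_betw_apply bij_betw_inv_into_left)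
  ultimately show ?case using qs by (intro exI[of _ "qs @ [?\<tau>]"]) auto
qed simp

text \<open>Each permutation is extended by the identity to the surplus states.\<close>

lemma computes_mono:
  assumes "computes A N L f" "N \<le> N'" "L \<le> L'"
  shows "computes A N' L' f"
proof -
  obtain ps where ps: "program A {..<N} ps" "length ps \<le> L"
    "\<And>z b. run ps z (of_bool b) = of_bool (b \<noteq> f z)" and N: "2 \<le> N"
    using assms(1) unfolding computes_def by auto
  define G where "G = (\<lambda>(\<pi>::nat \<Rightarrow> nat) n. if n < N then \<pi> n else n)"
  have G: "bij_betw (G \<pi>) {..<N'} {..<N'}" if "bij_betw \<pi> {..<N} {..<N}" for \<pi>
  proof -
    have "bij_betw (G \<pi>) ({..<N} \<union> {N..<N'}) ({..<N} \<union> {N..<N'})"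
    proof (rule bij_betw_combine)
      show "bij_betw (G \<pi>) {..<N} {..<N}"
        using that by (subst bij_betw_cong[of _ _ \<pi>]) (auto simp: G_def)
      show "bij_betw (G \<pi>) {N..<N'} {N..<N'}"
        by (subst bij_betw_cong[of _ _ id]) (auto simp: G_def)
    qed auto
    moreover have "{..<N} \<union> {N..<N'} = {..<N'}" using assms(2) by auto
    ultimately show ?thesis by simp
  qed
  let ?ps = "map (\<lambda>\<sigma> z. G (\<sigma> z)) ps"
  have "program A {..<N'} ?ps"
    using ps(1) by (auto simp: program_def intro!: local_step_map[where G = G] G)
  moreover have "run (map (\<lambda>\<sigma> z. G (\<sigma> z)) qs) z n = run qs z n"
    if "program A {..<N} qs" "n < N" for qs z n
    using that
  proof (induction qs arbitrary: n)
    case (Cons \<sigma> qs)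
    have "\<sigma> z n < N" using Cons.prems local_step_mem[of A "{..<N}" \<sigma> n z] by simp
    then show ?case using Cons by (simp add: G_def)
  qed simp
  ultimately show ?thesis unfolding computes_def using ps N assms(2,3)
    by (intro conjI exI[of _ ?ps]) auto
qed

text \<open>Conjugating every step by a fixed relabelling of the states keeps it a permutation and
  does not change which input it reads.\<close>

lemma run_transport:
  assumes h: "inj_on h S" and "program A S ps"
  defines "G \<equiv> \<lambda>\<pi> n. h (\<pi> (inv_into S h n))"
  shows "program A (h ` S) (map (\<lambda>\<sigma> z. G (\<sigma> z)) ps)"
    and "s \<in> S \<Longrightarrow> run (map (\<lambda>\<sigma> z. G (\<sigma> z)) ps) z (h s) = h (run ps z s)"
proof -
  have b: "bij_betw h S (h ` S)" using h by (rule inj_on_imp_bij_betw)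
  have G: "bij_betw (G \<pi>) (h ` S) (h ` S)" if "bij_betw \<pi> S S" for \<pi>
    using bij_betw_trans[OF bij_betw_trans[OF bij_betw_inv_into[OF b] that] b]
    by (simp add: G_def comp_def)
  show "program A (h ` S) (map (\<lambda>\<sigma> z. G (\<sigma> z)) ps)"
    using assms(2) by (auto simp: program_def intro!: local_step_map[where G = G] G)
  show "run (map (\<lambda>\<sigma> z. G (\<sigma> z)) ps) z (h s) = h (run ps z s)" if "s \<in> S"
    using assms(2) that
  proof (induction ps arbitrary: s)
    case (Cons \<sigma> ps)
    have "\<sigma> z s \<in> S" using Cons.prems local_step_mem[of A S \<sigma> s z] by simp
    then show ?case using Cons h by (simp add: G_def)
  qed simp
qed

text \<open>Allows programs to be built on any convenient finite state set; it is renumbered so that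
  the two states coding the bit become 0 and 1.\<close>

lemma computesI:
  assumes S: "finite S" "card S \<le> N" and e: "e False \<in> S" "e True \<in> S" "e False \<noteq> e True"
    and ps: "program A S ps" "\<And>z b. run ps z (e b) = e (b \<noteq> f z)"
    and L: "length ps \<le> L"
  shows "computes A N L f"
proof -
  let ?S = "S - {e False, e True}"
  have c2: "card S = card ?S + 2"
    using S(1) e by (metis (no_types, lifting) card_2_iff card_Diff_subset card_mono empty_subsetI finite.emptyI finite.insertI insert_subset le_add_diff_inverse2)
  have "card ?S = card {2..<card S}" using c2 by simp
  then obtain g where g: "bij_betw g ?S {2..<card S}"
    using finite_same_card_bij[of ?S "{2..<card S}"] S(1) by blast
  define h where "h = (\<lambda>s. if s = e False then 0 else if s = e True then 1 else g s)"
  have "bij_betw h ({e False, e True} \<union> ?S) ({0, 1} \<union> {2..<card S})"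
  proof (rule bij_betw_combine)
    show "bij_betw h {e False, e True} {0, 1}" using e(3) by (auto simp: h_def bij_betw_def)
    show "bij_betw h ?S {2..<card S}" using g by (subst bij_betw_cong[of _ _ g]) (auto simp: h_def)
  qed auto
  moreover have "{e False, e True} \<union> ?S = S" using e by auto
  moreover have "{0, 1} \<union> {2..<card S} = {..<card S}" using c2 by auto
  ultimately have "bij_betw h S {..<card S}" by metis
  then have h: "inj_on h S" "h ` S = {..<card S}" unfolding bij_betw_def by blast+
  have he: "h (e b) = of_bool b" for b using e(3) by (cases b) (auto simp: h_def)
  have eS: "e b \<in> S" for b using e by (cases b) auto
  let ?ps = "map (\<lambda>\<sigma> z n. h (\<sigma> z (inv_into S h n))) ps"
  have "run ?ps z (of_bool b) = of_bool (b \<noteq> f z)" for z b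
    using run_transport(2)[OF h(1) ps(1) eS, of z b] unfolding he ps(2) .
  moreover have "program A {..<card S} ?ps" using run_transport(1)[OF h(1) ps(1)] h(2) by simp
  ultimately have "computes A (card S) L f"
    unfolding computes_def using c2 L by (intro conjI exI[of _ ?ps]) auto
  then show ?thesis using S(2) computes_mono by blast
qed

section \<open>Programs on products of state sets: controlled steps and uncomputation\<close>

lemma local_step_snd:
  "local_step A Y \<sigma> \<Longrightarrow> local_step A (X \<times> Y) (\<lambda>z. map_prod id (\<sigma> z))"
  by (erule local_step_map) (intro bij_betw_map_prod bij_betw_id)

text \<open>The control \<open>n\<close> stays as it is, so the inverse of \<open>g n\<close> under
  the same control undoes the map.\<close>

lemma bij_betw_controlled:
  assumes "\<And>n. n \<in> Y \<Longrightarrow> bij_betw (g n) X X"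
  shows "bij_betw (\<lambda>(x, n). (g n x, n)) (X \<times> Y) (X \<times> Y)"
proof -
  have "inv_into X (g n) (g n x) = x" "g n (inv_into X (g n) x) = x" "g n x \<in> X"
    "inv_into X (g n) x \<in> X" if "x \<in> X" "n \<in> Y" for x n
    using assms[OF that(2)] bij_betw_inv_into[OF assms[OF that(2)]] that(1)
    by (auto simp: bij_betw_inv_into_left bij_betw_inv_into_right dest: bij_betw_apply)
  then show ?thesis
    by (intro bij_betw_byWitness[where f' = "\<lambda>(x, n). (inv_into X (g n) x, n)"]) auto
qed

lemma local_step_controlled:
  "(\<And>n. n \<in> Y \<Longrightarrow> bij_betw (g n) X X) \<Longrightarrow> local_step A (X \<times> Y) (\<lambda>z (x, n). (g n x, n))"
  by (rule local_step_const) (rule bij_betw_controlled)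

lemma run_map_snd: "run (map (\<lambda>\<sigma> z. map_prod id (\<sigma> z)) ps) z (x, y) = (x, run ps z y)"
  by (induction ps arbitrary: y) auto

lemma program_snd: "program A Y ps \<Longrightarrow> program A (X \<times> Y) (map (\<lambda>\<sigma> z. map_prod id (\<sigma> z)) ps)"
  by (auto simp: program_def intro: local_step_snd)

text \<open>Compute, add the value to an extra bit, uncompute. The extra bit doubles the number of
  states, and the middle step reads no input, so it is local for either player.\<close>

lemma computes_forward:
  assumes S: "finite S" "a \<in> S" "2 * card S \<le> N" and ps: "program A S ps" "2 * length ps + 1 \<le> L"
    and \<phi>: "\<And>z. \<phi> (run ps z a) = f z"
  shows "computes A N L f"
proof -
  obtain qs where qs: "program A S qs" "length qs = length ps"
    "\<And>z s. s \<in> S \<Longrightarrow> run qs z (run ps z s) = s"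
    using program_inverse[OF ps(1)] by blast
  let ?lift = "map (\<lambda>\<sigma> z. map_prod id (\<sigma> z))"
  let ?T = "\<lambda>z::input. \<lambda>(b::bool, s). ((b \<noteq> \<phi> s), s)"
  have "local_step A (UNIV \<times> S) ?T"
    by (rule local_step_controlled) (auto simp: bij_betw_def inj_on_def image_def)
  then have "program A (UNIV \<times> S) (?lift ps @ [?T] @ ?lift qs)"
    using ps(1) qs(1) by (simp add: program_snd)
  then show ?thesis
    using S ps qs \<phi>
    by (intro computesI[of "(UNIV::bool set) \<times> S" N "\<lambda>b. (b, a)" A "?lift ps @ [?T] @ ?lift qs"])
      (auto simp: run_map_snd)
qed

text \<open>Query, act under the control of the answer, query again. The second query adds
  \<open>f z\<close> once more and so returns the auxiliary state to 0, where it can be used for the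
  next query.\<close>

lemma computes_apply:
  assumes "computes A N L f" "bij_betw g X X"
  shows "\<exists>ps. program A (X \<times> {..<N}) ps \<and> length ps \<le> 2 * L + 1 \<and>
    (\<forall>z x. run ps z (x, 0) = ((if f z then g x else x), 0))"
proof -
  obtain ps where ps: "program A {..<N} ps" "length ps \<le> L"
    "\<And>z b. run ps z (of_bool b) = of_bool (b \<noteq> f z)"
    using assms(1) unfolding computes_def by auto
  let ?lift = "map (\<lambda>\<sigma> z. map_prod id (\<sigma> z)) ps"
  let ?T = "\<lambda>z::input. \<lambda>(x, n::nat). ((if n = 1 then g x else x), n)"
  have "local_step A (X \<times> {..<N}) ?T"
    using assms(2) local_step_controlled[of "{..<N}" "\<lambda>n x. if n = 1 then g x else x" X A]
    by (auto simp: if_distrib[of "\<lambda>h. bij_betw h X X"] bij_betw_def inj_on_def)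
  then have "program A (X \<times> {..<N}) (?lift @ [?T] @ ?lift)"
    using ps(1) by (simp add: program_snd)
  moreover have "run (?lift @ [?T] @ ?lift) z (x, 0) = ((if f z then g x else x), 0)" for z x
    using ps(3)[of z False] ps(3)[of z True] by (cases "f z") (auto simp: run_map_snd)
  ultimately show ?thesis using ps(2) by (intro exI[of _ "?lift @ [?T] @ ?lift"]) auto
qed

text \<open>Each value is written into a bit of its own by a conditional flip; then
  \<open>computes_forward\<close> reads off \<open>op\<close> and cleans up. Two such bits and the
  output bit give the factor 8.\<close>

lemma computes_op:
  assumes f: "computes A N L1 f" and g: "computes A N L2 g"
  shows "computes A (8 * N) (4 * L1 + 4 * L2 + 5) (\<lambda>z. op (f z) (g z))"
proof -
  let ?X = "UNIV :: (bool \<times> bool) set"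
  have "bij_betw (map_prod Not id) ?X ?X" "bij_betw (map_prod id Not) ?X ?X"
    by (auto simp: bij_betw_def inj_on_def image_def)
  from computes_apply[OF f this(1)] computes_apply[OF g this(2)]
  obtain ps qs where p: "program A (?X \<times> {..<N}) ps" "length ps \<le> 2 * L1 + 1"
    "\<And>z x. run ps z (x, 0) = ((if f z then map_prod Not id x else x), 0)"
    and q: "program A (?X \<times> {..<N}) qs" "length qs \<le> 2 * L2 + 1"
    "\<And>z x. run qs z (x, 0) = ((if g z then map_prod id Not x else x), 0)"
    by blast
  have N: "2 \<le> N" using f unfolding computes_def by simp
  show ?thesis
  proof (rule computes_forward[where S = "?X \<times> {..<N}" and a = "((False, False), 0)"
        and ps = "ps @ qs" and \<phi> = "\<lambda>((a, b), n). op a b"])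
    have "card ?X = 4" unfolding UNIV_Times_UNIV[symmetric] card_cartesian_product by simp
    then show "2 * card (?X \<times> {..<N}) \<le> 8 * N" by (simp add: card_cartesian_product)
  qed (use p q N in auto)
qed

lemma computes_const: "2 \<le> N \<Longrightarrow> computes A N 1 (\<lambda>z. b)"
  using computes_forward[of "{0::nat}" 0 N A "[]" 1 "\<lambda>_. b"] by simp

lemma computes_var: "2 \<le> N \<Longrightarrow> computes A N 1 (\<lambda>z. z i \<noteq> b)"
proof -
  assume N: "2 \<le> N"
  let ?\<sigma> = "\<lambda>(z::input) c. c \<noteq> (z i \<noteq> b)"
  have "depends_on A ?\<sigma> \<or> depends_on (- A) ?\<sigma>"
    unfolding depends_on_def by (cases "i \<in> A") (auto intro!: ext)
  moreover have "bij_betw (?\<sigma> z) UNIV UNIV" for z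
    by (auto simp: bij_betw_def inj_on_def image_def)
  ultimately have "local_step A UNIV ?\<sigma>" unfolding local_step_def by blast
  then show ?thesis
    using N by (intro computesI[of "UNIV::bool set" N id A "[?\<sigma>]"]) (auto simp: id_def)
qed

section \<open>From programs to garden-hose protocols\<close>

lemma matching_onI:
  assumes "\<And>e. e \<in> E \<Longrightarrow> e \<subseteq> W \<and> card e = 2"
    and "\<And>e e' v. e \<in> E \<Longrightarrow> e' \<in> E \<Longrightarrow> v \<in> e \<Longrightarrow> v \<in> e' \<Longrightarrow> e = e'"
  shows "matching_on W E"
  using assms unfolding matching_on_def pairwise_def disjnt_iff by metis

lemma gh_output_eq:
  assumes "matching_on (insert t V) A" "matching_on V B" "t \<notin> V" "finite V"
    and "path_from (A \<union> B) t p" "\<And>v. {last p, v} \<in> A \<union> B \<Longrightarrow> v \<in> set p"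
  shows "gh_output (A \<union> B) t = odd (length p - 1)"
proof -
  have "p \<noteq> []" using assms(5) unfolding path_from_def by simp
  then have "maximal_path_from (A \<union> B) t p"
    using assms(5,6) unfolding maximal_path_from_def by (auto simp: path_from_snoc)
  then have "(THE p. maximal_path_from (A \<union> B) t p) = p"
    using ex1_maximal_path_from[OF assms(1-4)] by (auto intro: the1_equality)
  then show ?thesis unfolding gh_output_def by simp
qed

text \<open>The pipe ends are the pairs of a time and a state, and the path from the tap follows the
  run that starts in state 0. Transitions belong alternately to Bob and Alice, so that neither
  player ever uses a vertex twice.\<close>

lemma GH_le_computes:
  assumes "A \<subseteq> {..<n}" and f: "computes A N L f" and g: "\<And>z. z \<in> cube {..<n} \<Longrightarrow> g z = f z"
  shows "GH (cube A) (cube ({..<n} - A)) (split_fun A g) \<le> enat (N * (2 * L + 1) + 1)"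
proof -
  obtain ps where ps: "program A {..<N} ps" "length ps \<le> L"
    "\<And>z b. run ps z (of_bool b) = of_bool (b \<noteq> f z)" and N: "2 \<le> N"
    using f unfolding computes_def by auto
  define l where "l = length ps"
  define \<sigma> where "\<sigma> j = ps ! (j div 2)" for j
  define bob where "bob j \<longleftrightarrow> depends_on (- A) (\<sigma> j)" for j
  \<comment> \<open>Every program step is spread over two transitions, an even one for Bob and an
    odd one for Alice. It acts in the one whose owner knows the input it reads; the other is the
    identity.\<close>
  define st :: "nat \<Rightarrow> nat step" where
    "st j = (if even j = bob j then \<sigma> j else (\<lambda>z. id))" for j
  have \<sigma>: "local_step A {..<N} (\<sigma> j)" if "j < 2 * l" for j
    using ps(1) that unfolding program_def \<sigma>_def l_def by simp
  have st_bij: "bij_betw (st j z) {..<N} {..<N}" if "j < 2 * l" for j z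
    using \<sigma>[OF that] unfolding st_def local_step_def by simp
  have st_less: "st j z s < N" if "j < 2 * l" "s < N" for j z s
    using bij_betw_apply[OF st_bij[OF that(1)], of s z] that by simp
  have st_inj: "st j z s = st j z s' \<longleftrightarrow> s = s'" if "j < 2 * l" "s < N" "s' < N" for j z s s'
    using st_bij[OF that(1), of z] that unfolding bij_betw_def by (meson inj_on_eq_iff lessThan_iff)
  have stB: "st j z = st j y" if "j < 2 * l" "even j" "\<And>i. i \<notin> A \<Longrightarrow> z i = y i" for j z y
    using \<sigma>[OF that(1)] that unfolding st_def bob_def local_step_def depends_on_def by auto
  have stA: "st j z = st j x" if "j < 2 * l" "odd j" "\<And>i. i \<in> A \<Longrightarrow> z i = x i" for j z x
    using \<sigma>[OF that(1)] that unfolding st_def bob_def local_step_def depends_on_def by auto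
  define pos where "pos z j = rec_nat (0::nat) (\<lambda>j s. st j z s) j" for z j
  have pos0: "pos z 0 = 0" and posS: "pos z (Suc j) = st j z (pos z j)" for z j
    by (simp_all add: pos_def)
  have pos_less: "pos z j < N" if "j \<le> 2 * l" for z j
    using that N by (induction j) (auto simp: pos0 posS intro!: st_less)
  have "pos z (2 * j) = run (take j ps) z 0" if "j \<le> l" for z j
    using that
  proof (induction j)
    case (Suc j)
    have "j < length ps" using Suc.prems by (simp add: l_def)
    then have "run (take (Suc j) ps) z 0 = (ps ! j) z (run (take j ps) z 0)"
      by (simp add: take_Suc_conv_app_nth)
    moreover have "pos z (2 * Suc j) = st (Suc (2 * j)) z (st (2 * j) z (pos z (2 * j)))"
      by (simp add: posS)
    moreover have "\<sigma> (Suc (2 * j)) = ps ! j" "\<sigma> (2 * j) = ps ! j" by (simp_all add: \<sigma>_def)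
    ultimately show ?case using Suc by (auto simp: st_def bob_def)
  qed (simp add: pos0)
  from this[of l] have pos_end: "pos z (2 * l) = of_bool (f z)" for z
    using ps(3)[of z False] by (simp add: l_def)
  define enc where "enc j s = prod_encode (j, s)" for j s
  have enc: "enc j s = enc j' s' \<longleftrightarrow> j = j' \<and> s = s'" for j s j' s' by (simp add: enc_def)
  \<comment> \<open>The layer numbers \<open>2 * l + 1\<close> and \<open>2 * l + 2\<close> do not
    occur among the states, so the exit and the tap are new vertices.\<close>
  define ex where "ex = enc (2 * l + 1) 0"
  define t where "t = enc (2 * l + 2) 0"
  define V where "V = insert ex (case_prod enc ` ({..2 * l} \<times> {..<N}))"
  have V: "enc j s \<in> V" if "j \<le> 2 * l" "s < N" for j s using that unfolding V_def by auto
  have finV: "finite V" unfolding V_def by simp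
  have tV: "t \<notin> V" unfolding V_def t_def ex_def by (auto simp: enc)
  have cardV: "card V \<le> N * (2 * L + 1) + 1"
  proof -
    have "card V \<le> Suc (card (case_prod enc ` ({..2 * l} \<times> {..<N})))"
      unfolding V_def by (rule card_insert_le_m1) auto
    also have "\<dots> \<le> Suc (card ({..2 * l} \<times> {..<N}))" by (intro iffD2[OF Suc_le_mono] card_image_le) simp
    also have "\<dots> = N * (2 * l + 1) + 1" by (simp add: card_cartesian_product)
    also have "\<dots> \<le> N * (2 * L + 1) + 1" using ps(2) unfolding l_def by simp
    finally show ?thesis .
  qed
  define edge where "edge z j s = {enc j s, enc (Suc j) (st j z s)}" for z j s
  define E where "E P z = {edge z j s | j s. j < 2 * l \<and> P j \<and> s < N}" for P z
  \<comment> \<open>The edges of transition \<open>j\<close> join layers \<open>j\<close> and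
    \<open>Suc j\<close>, so two edges of equal parity can meet only within one transition, where
    injectivity of the step excludes it.\<close>
  have E_uniq: "j = j' \<and> s = s'"
    if "v \<in> edge z j s" "v \<in> edge z j' s'" "j < 2 * l" "j' < 2 * l" "s < N" "s' < N" "even j = even j'"
    for v z j s j' s'
    using that st_inj[of j s s' z] unfolding edge_def by (auto simp: enc)
  have E_size: "edge z j s \<subseteq> V \<and> card (edge z j s) = 2" if "j < 2 * l" "s < N" for z j s
    using that V st_less unfolding edge_def by (auto simp: enc)
  have E_insert_uniq: "e = e'"
    if dis: "\<And>j s. j < 2 * l \<Longrightarrow> P j \<Longrightarrow> e0 \<inter> edge z j s = {}"
      and e: "e \<in> insert e0 (E P z)" "e' \<in> insert e0 (E P z)" "v \<in> e" "v \<in> e'"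
      and P: "\<And>j j'. P j \<Longrightarrow> P j' \<Longrightarrow> even j = even j'" for P e0 z e e' v
  proof -
    have c: "x = e0 \<or> (\<exists>j s. x = edge z j s \<and> j < 2 * l \<and> P j \<and> s < N)"
      if "x \<in> insert e0 (E P z)" for x
      using that unfolding E_def by blast
    from c[OF e(1)] c[OF e(2)] show ?thesis
    proof (elim disjE exE conjE)
      fix j s j' s'
      assume j: "e = edge z j s" "j < 2 * l" "P j" "s < N" "e' = edge z j' s'" "j' < 2 * l" "P j'" "s' < N"
      then have "j = j' \<and> s = s'" using E_uniq[of v z j s j' s'] e(3,4) P[of j j'] by simp
      then show ?thesis using j by simp
    qed (use dis e(3,4) in blast)+
  qed
  \<comment> \<open>The tap leads into state 0 of layer 0. At the end only state 0, which stands for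
    false, is prolonged to \<open>ex\<close>: the path has \<open>2 * l + 1\<close> edges for true
    and \<open>2 * l + 2\<close> for false.\<close>
  define EA where "EA x = insert {t, enc 0 0} (E odd x)" for x
  define EB where "EB y = insert {enc (2 * l) 0, ex} (E even y)" for y
  have mA: "matching_on (insert t V) (EA x)" for x
  proof (rule matching_onI)
    have dis: "{t, enc 0 0} \<inter> edge x j s = {}" if "j < 2 * l" "odd j" for j s
      using that odd_pos[of j] unfolding edge_def t_def by (auto simp: enc)
    fix e e' v assume e: "e \<in> EA x" "e' \<in> EA x" "v \<in> e" "v \<in> e'"
    show "e = e'"
    proof (rule E_insert_uniq[OF dis _ _ e(3,4)])
      show "e \<in> insert {t, enc 0 0} (E odd x)" "e' \<in> insert {t, enc 0 0} (E odd x)"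
        using e unfolding EA_def by simp_all
    qed auto
  next
    fix e assume "e \<in> EA x"
    then consider "e = {t, enc 0 0}" | j s where "e = edge x j s" "j < 2 * l" "s < N"
      unfolding EA_def E_def by blast
    then show "e \<subseteq> insert t V \<and> card e = 2"
    proof cases
      case 1
      have "t \<noteq> enc 0 0" by (simp add: t_def enc)
      then show ?thesis using 1 V[of 0 0] N by simp
    next
      case 2
      then show ?thesis using E_size[of j s x] by auto
    qed
  qed
  have mB: "matching_on V (EB y)" for y
  proof (rule matching_onI)
    have dis: "{enc (2 * l) 0, ex} \<inter> edge y j s = {}" if "j < 2 * l" "even j" for j s
    proof -
      have "Suc j \<noteq> 2 * l" using that(2) by presburger
      then show ?thesis using that unfolding edge_def ex_def by (auto simp: enc)
    qed
    fix e e' v assume e: "e \<in> EB y" "e' \<in> EB y" "v \<in> e" "v \<in> e'"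
    show "e = e'"
    proof (rule E_insert_uniq[OF dis _ _ e(3,4)])
      show "e \<in> insert {enc (2 * l) 0, ex} (E even y)" "e' \<in> insert {enc (2 * l) 0, ex} (E even y)"
        using e unfolding EB_def by simp_all
    qed auto
  next
    fix e assume "e \<in> EB y"
    then consider "e = {enc (2 * l) 0, ex}" | j s where "e = edge y j s" "j < 2 * l" "s < N"
      unfolding EB_def E_def by blast
    then show "e \<subseteq> V \<and> card e = 2"
    proof cases
      case 1
      have "enc (2 * l) 0 \<noteq> ex" "ex \<in> V" by (simp_all add: ex_def enc V_def)
      then show ?thesis using 1 V[of "2 * l" 0] N by simp
    next
      case 2
      then show ?thesis using E_size[of j s y] by auto
    qed
  qed
  have out: "gh_output (EA x \<union> EB y) t = split_fun A g x y"
    if x: "x \<in> cube A" and y: "y \<in> cube ({..<n} - A)" for x y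
  proof -
    define z where "z = override_on y x A"
    have fz: "split_fun A g x y = f z"
      unfolding split_fun_def z_def by (rule g[OF override_on_cube[OF assms(1) x y]])
    have zA: "z i = x i" if "i \<in> A" for i using that by (simp add: z_def)
    have zB: "z i = y i" if "i \<notin> A" for i using that by (simp add: z_def)
    have E: "edge z j (pos z j) \<in> EA x \<union> EB y" if "j < 2 * l" for j
    proof (cases "even j")
      case True
      then have "edge z j (pos z j) = edge y j (pos z j)" by (simp add: edge_def stB[OF that True zB])
      then show ?thesis using True that pos_less[of j z] unfolding EB_def E_def by auto
    next
      case False
      then have "edge z j (pos z j) = edge x j (pos z j)" by (simp add: edge_def stA[OF that False zA])
      then show ?thesis using False that pos_less[of j z] unfolding EA_def E_def by auto
    qed
    define q where "q j = map (\<lambda>i. enc i (pos z i)) [0..<Suc j]" for j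
    have path: "path_from (EA x \<union> EB y) t (t # q j)" if "j \<le> 2 * l" for j
      using that
    proof (induction j)
      case 0
      then show ?case unfolding path_from_def q_def EA_def t_def by (auto simp: enc pos0)
    next
      case (Suc j)
      have "q (Suc j) = q j @ [enc (Suc j) (pos z (Suc j))]" by (simp add: q_def)
      moreover have "last (t # q j) = enc j (pos z j)" by (simp add: q_def)
      moreover have "{enc j (pos z j), enc (Suc j) (pos z (Suc j))} \<in> EA x \<union> EB y"
        using E[of j] Suc.prems unfolding edge_def posS by simp
      ultimately show ?case
        using Suc path_from_snoc[of "EA x \<union> EB y" t "t # q j"]
        by (auto simp: q_def t_def enc)
    qed
    have last: "last (t # q (2 * l)) = enc (2 * l) (of_bool (f z))"
      by (simp add: q_def pos_end)
    have len: "length (q j) = Suc j" for j by (simp add: q_def)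
    show ?thesis
    proof (cases "f z")
      case True
      \<comment> \<open>For the value true the path ends in state 1 of the last layer: the exit edge
        starts at state 0, and the only edge of Alice there is the one by which the path
        arrived.\<close>
      have "v \<in> set (t # q (2 * l))" if "{last (t # q (2 * l)), v} \<in> EA x \<union> EB y" for v
      proof -
        have "{enc (2 * l) 1, v} \<noteq> {enc (2 * l) 0, ex}" by (auto simp: ex_def enc doubleton_eq_iff)
        moreover have "{enc (2 * l) 1, v} \<in> EA x \<union> EB y"
          using that unfolding last using True by simp
        ultimately consider (tap) "{enc (2 * l) 1, v} = {t, enc 0 0}"
          | (E) "{enc (2 * l) 1, v} \<in> E odd x" | (B) "{enc (2 * l) 1, v} \<in> E even y"
          unfolding EA_def EB_def by blast
        then show ?thesis
        proof cases
          case tap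
          then show ?thesis by (auto simp: enc t_def doubleton_eq_iff)
        next
          case E
          then have l: "0 < l" unfolding E_def by auto
          define j where "j = 2 * l - 1"
          have j: "Suc j = 2 * l" "j < 2 * l" "odd j" using l by (auto simp: j_def)
          have "pos z (2 * l) = st j x (pos z j)"
            unfolding j(1)[symmetric] posS by (subst stA[OF j(2,3) zA]) simp_all
          then have "edge x j (pos z j) = {enc j (pos z j), enc (2 * l) 1}"
            using pos_end[of z] True j(1) by (simp add: edge_def)
          moreover have "edge x j (pos z j) \<in> EA x"
            using j(2,3) pos_less[of j z, OF less_imp_le] unfolding EA_def E_def by blast
          ultimately have "{enc (2 * l) 1, enc j (pos z j)} \<in> EA x" by (simp add: insert_commute)
          moreover have "{enc (2 * l) 1, v} \<in> EA x" using E by (simp add: EA_def)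
          ultimately have "v = enc j (pos z j)" using matching_on_unique[OF mA] by blast
          then show ?thesis using j(2) by (auto simp: q_def)
        next
          case B
          then obtain j s where j: "{enc (2 * l) 1, v} = edge y j s" "j < 2 * l" "even j"
            unfolding E_def by blast
          then have "enc (2 * l) 1 \<in> edge y j s" by auto
          moreover have "Suc j \<noteq> 2 * l" using j(3) by presburger
          ultimately show ?thesis using j(2) by (auto simp: edge_def enc)
        qed
      qed
      then show ?thesis
        using gh_output_eq[OF mA mB tV finV path[of "2 * l"]] True fz len by simp
    next
      case False
      let ?p = "t # q (2 * l) @ [ex]"
      have "ex \<notin> set (t # q (2 * l))" by (auto simp: q_def t_def ex_def enc)
      then have "path_from (EA x \<union> EB y) t ?p"
        using path[of "2 * l"] last False
          path_from_snoc[of "EA x \<union> EB y" t "t # q (2 * l)" ex]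
        by (auto simp: EB_def)
      moreover have "v \<in> set ?p" if "{last ?p, v} \<in> EA x \<union> EB y" for v
      proof -
        have "ex \<notin> edge w j s" if "j < 2 * l" for w j s
          using that unfolding edge_def ex_def by (auto simp: enc)
        moreover have "ex \<noteq> t" "ex \<noteq> enc 0 0" by (auto simp: ex_def t_def enc)
        ultimately have "{ex, v} = {enc (2 * l) 0, ex}"
          using that unfolding EA_def EB_def E_def by auto
        then have "v = last (t # q (2 * l))" using last False by (auto simp: doubleton_eq_iff)
        then show ?thesis by (auto simp: len q_def)
      qed
      ultimately show ?thesis
        using gh_output_eq[OF mA mB tV finV, of x y ?p] False fz len by simp
    qed
  qed
  have "gh_protocol (cube A) (cube ({..<n} - A)) V t EA EB"
    unfolding gh_protocol_def using finV tV mA mB by blast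
  moreover have "gh_computes (cube A) (cube ({..<n} - A)) t EA EB (split_fun A g)"
    unfolding gh_computes_def using out by blast
  ultimately have "GH (cube A) (cube ({..<n} - A)) (split_fun A g) \<le> enat (card V)"
    unfolding GH_def by (intro Inf_lower) blast
  also have "\<dots> \<le> enat (N * (2 * L + 1) + 1)" using cardV by simp
  finally show ?thesis .
qed

section \<open>Evaluating a tree with dirty registers\<close>

datatype 'l tree = Leaf 'l | Conj "'l tree" "'l tree" | Plus "'l tree" "'l tree"

fun tree_eval :: "('l \<Rightarrow> bool) \<Rightarrow> 'l tree \<Rightarrow> bool" where
  "tree_eval v (Leaf l) = v l"
| "tree_eval v (Conj S T) = (tree_eval v S \<and> tree_eval v T)"
| "tree_eval v (Plus S T) = (tree_eval v S \<noteq> tree_eval v T)"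

fun labels :: "'l tree \<Rightarrow> 'l list" where
  "labels (Leaf l) = [l]"
| "labels (Conj S T) = labels S @ labels T"
| "labels (Plus S T) = labels S @ labels T"

section \<open>Instructions on registers over GF(2)\<close>

type_synonym 'l gate = "nat \<times> nat \<times> 'l"

text \<open>Over GF(2) this is \<open>\<rho> b += \<rho> a * v l\<close>: addition of bits is
  written as inequality and multiplication as conjunction.\<close>

definition add_prod :: "('l \<Rightarrow> bool) \<Rightarrow> nat \<Rightarrow> nat \<Rightarrow> 'l \<Rightarrow> (nat \<Rightarrow> bool) \<Rightarrow> nat \<Rightarrow> bool" where
  "add_prod v a b l \<rho> = \<rho>(b := (\<rho> b \<noteq> (\<rho> a \<and> v l)))"

fun exec :: "('l \<Rightarrow> bool) \<Rightarrow> 'l gate list \<Rightarrow> (nat \<Rightarrow> bool) \<Rightarrow> nat \<Rightarrow> bool" where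
  "exec v [] \<rho> = \<rho>"
| "exec v ((a, b, l) # gs) \<rho> = exec v gs (add_prod v a b l \<rho>)"

definition gates_on :: "nat set \<Rightarrow> 'l gate list \<Rightarrow> bool" where
  "gates_on W gs \<longleftrightarrow> (\<forall>(a, b, l)\<in>set gs. a \<in> W \<and> b \<in> W \<and> a \<noteq> b)"

lemma exec_append [simp]: "exec v (gs @ hs) \<rho> = exec v hs (exec v gs \<rho>)"
  by (induction v gs \<rho> rule: exec.induct) auto

lemma gates_on_simps [simp]:
  "gates_on W []"
  "gates_on W ((a, b, l) # gs) \<longleftrightarrow> a \<in> W \<and> b \<in> W \<and> a \<noteq> b \<and> gates_on W gs"
  "gates_on W (gs @ hs) \<longleftrightarrow> gates_on W gs \<and> gates_on W hs"
  "gates_on W (rev gs) \<longleftrightarrow> gates_on W gs"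
  unfolding gates_on_def by (simp_all add: ball_Un)

lemma gates_on_mono: "gates_on W gs \<Longrightarrow> W \<subseteq> W' \<Longrightarrow> gates_on W' gs"
  unfolding gates_on_def by fastforce

text \<open>Source and target of a gate differ, so every gate is an involution and the reversed list
  is the inverse.\<close>

lemma exec_rev: "gates_on W gs \<Longrightarrow> exec v (rev gs) (exec v gs \<rho>) = \<rho>"
proof (induction v gs \<rho> rule: exec.induct)
  case (2 v a b l gs \<rho>)
  then have "a \<noteq> b"
    and "exec v (rev gs) (exec v gs (add_prod v a b l \<rho>)) = add_prod v a b l \<rho>" by simp_all
  moreover from \<open>a \<noteq> b\<close> have "add_prod v a b l (add_prod v a b l \<rho>) = \<rho>"
    by (auto simp: add_prod_def fun_eq_iff)
  ultimately show ?case by simp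
qed simp

lemma exec_outside: "gates_on W gs \<Longrightarrow> i \<notin> W \<Longrightarrow> exec v gs \<rho> i = \<rho> i"
  by (induction v gs \<rho> rule: exec.induct) (auto simp: add_prod_def)

text \<open>A sweep evaluates the tree once, with garbage that depends only on the
  initial contents of the internal registers \<open>I\<close>.\<close>

definition sweep :: "'l tree \<Rightarrow> nat \<Rightarrow> nat \<Rightarrow> nat set \<Rightarrow> 'l gate list \<Rightarrow> bool" where
  "sweep T u v I gs \<longleftrightarrow> map (snd \<circ> snd) gs = labels T \<and> gates_on (insert u (insert v I)) gs \<and>
     (\<forall>w \<rho> i. i \<notin> insert v I \<longrightarrow> exec w gs \<rho> i = \<rho> i) \<and>
     (\<exists>garb. (\<forall>w \<rho> \<rho>'. (\<forall>i\<in>I. \<rho> i = \<rho>' i) \<longrightarrow> garb w \<rho> = garb w \<rho>') \<and>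
        (\<forall>w \<rho>. exec w gs \<rho> v = ((\<rho> v \<noteq> (\<rho> u \<and> tree_eval w T)) \<noteq> garb w \<rho>)))"

lemma sweepE:
  assumes "sweep T u v I gs"
  obtains garb where "map (snd \<circ> snd) gs = labels T" "gates_on (insert u (insert v I)) gs"
    "\<forall>w \<rho> i. i \<notin> insert v I \<longrightarrow> exec w gs \<rho> i = \<rho> i"
    "\<forall>w \<rho> \<rho>'. (\<forall>i\<in>I. \<rho> i = \<rho>' i) \<longrightarrow> garb w \<rho> = garb w \<rho>'"
    "\<forall>w \<rho>. exec w gs \<rho> v = ((\<rho> v \<noteq> (\<rho> u \<and> tree_eval w T)) \<noteq> garb w \<rho>)"
  using assms unfolding sweep_def by (elim conjE exE) (rule that; assumption)

lemma labels_pos: "1 \<le> length (labels T)"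
  by (induction T) auto

lemma ex_disjoint_subsets:
  assumes "finite I" "m + n \<le> card I"
  obtains I1 I2 where "I1 \<subseteq> I" "I2 \<subseteq> I" "I1 \<inter> I2 = {}" "card I1 = m" "card I2 = n"
proof -
  obtain I1 where I1: "I1 \<subseteq> I" "card I1 = m"
    using obtain_subset_with_card_n[of m I] assms by auto
  then have "n \<le> card (I - I1)" using assms by (simp add: card_Diff_subset finite_subset)
  then obtain I2 where "I2 \<subseteq> I - I1" "card I2 = n"
    using obtain_subset_with_card_n[of n "I - I1"] by auto
  with I1 that[of I1 I2] show ?thesis by blast
qed

text \<open>For a conjunction, \<open>S\<close> is added into an internal register \<open>w\<close>,
  which then serves as the source for \<open>T\<close>; for a sum, both subtrees go from
  \<open>u\<close> to \<open>v\<close>. The internal registers of the subtrees are disjoint, so the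
  second sweep finds its own ones untouched. Only a conjunction consumes a register, hence one less
  than the number of leaves is enough.\<close>

lemma ex_sweep:
  assumes "finite I" "length (labels T) \<le> Suc (card I)" "u \<noteq> v" "u \<notin> I" "v \<notin> I"
  shows "\<exists>gs. sweep T u v I gs"
  using assms
proof (induction T arbitrary: u v I)
  case (Leaf l)
  have "sweep (Leaf l) u v I [(u, v, l)]"
    using Leaf.prems unfolding sweep_def by (auto simp: add_prod_def intro!: exI[of _ "\<lambda>_ _. False"])
  then show ?case by blast
next
  case (Conj S T)
  let ?m = "length (labels S) - 1" and ?n = "length (labels T) - 1"
  have mn: "?m + ?n < card I" using Conj.prems(2) labels_pos[of S] labels_pos[of T] by simp
  then have "I \<noteq> {}" by auto
  then obtain w where w: "w \<in> I" by blast
  then have "?m + ?n \<le> card (I - {w})" using mn Conj.prems(1) by simp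
  then obtain I1 I2 where I: "I1 \<subseteq> I - {w}" "I2 \<subseteq> I - {w}" "I1 \<inter> I2 = {}"
    "card I1 = ?m" "card I2 = ?n"
    using ex_disjoint_subsets[of "I - {w}" ?m ?n] Conj.prems(1) by auto
  have fin: "finite I1" "finite I2" using I Conj.prems(1) by (auto intro: finite_subset)
  have ne: "u \<noteq> w" "u \<notin> I1" "w \<notin> I1" "w \<noteq> v" "w \<notin> I2" "v \<notin> I2"
    using I w Conj.prems by blast+
  have len: "length (labels S) \<le> Suc (card I1)" "length (labels T) \<le> Suc (card I2)"
    using I(4,5) by simp_all
  obtain gs where gs: "sweep S u w I1 gs"
    using Conj.IH(1)[OF fin(1) len(1) ne(1-3)] by blast
  obtain hs where hs: "sweep T w v I2 hs"
    using Conj.IH(2)[OF fin(2) len(2) ne(4-6)] by blast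
  from gs obtain g1 where g': "map (snd \<circ> snd) gs = labels S" "gates_on (insert u (insert w I1)) gs"
    "\<forall>x \<rho> i. i \<notin> insert w I1 \<longrightarrow> exec x gs \<rho> i = \<rho> i"
    "\<forall>x \<rho> \<rho>'. (\<forall>i\<in>I1. \<rho> i = \<rho>' i) \<longrightarrow> g1 x \<rho> = g1 x \<rho>'"
    "\<forall>x \<rho>. exec x gs \<rho> w = ((\<rho> w \<noteq> (\<rho> u \<and> tree_eval x S)) \<noteq> g1 x \<rho>)"
    by (rule sweepE) (rule that; assumption)
  note g = g'[rule_format]
  from hs obtain g2 where h': "map (snd \<circ> snd) hs = labels T" "gates_on (insert w (insert v I2)) hs"
    "\<forall>x \<rho> i. i \<notin> insert v I2 \<longrightarrow> exec x hs \<rho> i = \<rho> i"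
    "\<forall>x \<rho> \<rho>'. (\<forall>i\<in>I2. \<rho> i = \<rho>' i) \<longrightarrow> g2 x \<rho> = g2 x \<rho>'"
    "\<forall>x \<rho>. exec x hs \<rho> v = ((\<rho> v \<noteq> (\<rho> w \<and> tree_eval x T)) \<noteq> g2 x \<rho>)"
    by (rule sweepE) (rule that; assumption)
  note h = h'[rule_format]
  \<comment> \<open>This is what remains of \<open>(w + u * S + g1) * T + g2\<close> once
    \<open>u * S * T\<close> is taken away; it reads internal registers only.\<close>
  let ?garb = "\<lambda>x \<rho>. (((\<rho> w \<noteq> g1 x \<rho>) \<and> tree_eval x T) \<noteq> g2 x \<rho>)"
  have "sweep (Conj S T) u v I (gs @ hs)"
    unfolding sweep_def
  proof (intro conjI exI[of _ ?garb] allI impI)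
    show "map (snd \<circ> snd) (gs @ hs) = labels (Conj S T)" using g(1) h(1) by simp
    show "gates_on (insert u (insert v I)) (gs @ hs)"
      using g(2) h(2) I w by (auto elim!: gates_on_mono)
    show "exec x (gs @ hs) \<rho> i = \<rho> i" if "i \<notin> insert v I" for x \<rho> i
    proof -
      have "i \<notin> insert v I2" "i \<notin> insert w I1" using that I w by auto
      then show ?thesis using g(3) h(3) by simp
    qed
    show "?garb x \<rho> = ?garb x \<rho>'" if "\<forall>i\<in>I. \<rho> i = \<rho>' i" for x \<rho> \<rho>'
      using that g(4)[of \<rho> \<rho>' x] h(4)[of \<rho> \<rho>' x] I w by auto
    fix x \<rho>
    have "v \<notin> insert w I1" using I w Conj.prems by auto
    then have v: "exec x gs \<rho> v = \<rho> v" by (rule g(3))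
    have "g2 x (exec x gs \<rho>) = g2 x \<rho>"
    proof (rule h(4))
      fix i assume "i \<in> I2"
      then have "i \<notin> insert w I1" using I by auto
      then show "exec x gs \<rho> i = \<rho> i" by (rule g(3))
    qed
    then show "exec x (gs @ hs) \<rho> v = ((\<rho> v \<noteq> (\<rho> u \<and> tree_eval x (Conj S T))) \<noteq> ?garb x \<rho>)"
      unfolding exec_append h(5) v g(5) by auto
  qed
  then show ?case by blast
next
  case (Plus S T)
  let ?m = "length (labels S) - 1" and ?n = "length (labels T) - 1"
  have "?m + ?n \<le> card I" using Plus.prems(2) labels_pos[of S] labels_pos[of T] by simp
  then obtain I1 I2 where I: "I1 \<subseteq> I" "I2 \<subseteq> I" "I1 \<inter> I2 = {}"
    "card I1 = ?m" "card I2 = ?n"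
    using ex_disjoint_subsets[of I ?m ?n] Plus.prems(1) by auto
  have fin: "finite I1" "finite I2" using I Plus.prems(1) by (auto intro: finite_subset)
  have ne: "u \<notin> I1" "v \<notin> I1" "u \<notin> I2" "v \<notin> I2"
    using I Plus.prems by blast+
  have len: "length (labels S) \<le> Suc (card I1)" "length (labels T) \<le> Suc (card I2)"
    using I(4,5) by simp_all
  obtain gs where gs: "sweep S u v I1 gs"
    using Plus.IH(1)[OF fin(1) len(1) Plus.prems(3) ne(1,2)] by blast
  obtain hs where hs: "sweep T u v I2 hs"
    using Plus.IH(2)[OF fin(2) len(2) Plus.prems(3) ne(3,4)] by blast
  from gs obtain g1 where g': "map (snd \<circ> snd) gs = labels S" "gates_on (insert u (insert v I1)) gs"
    "\<forall>x \<rho> i. i \<notin> insert v I1 \<longrightarrow> exec x gs \<rho> i = \<rho> i"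
    "\<forall>x \<rho> \<rho>'. (\<forall>i\<in>I1. \<rho> i = \<rho>' i) \<longrightarrow> g1 x \<rho> = g1 x \<rho>'"
    "\<forall>x \<rho>. exec x gs \<rho> v = ((\<rho> v \<noteq> (\<rho> u \<and> tree_eval x S)) \<noteq> g1 x \<rho>)"
    by (rule sweepE) (rule that; assumption)
  note g = g'[rule_format]
  from hs obtain g2 where h': "map (snd \<circ> snd) hs = labels T" "gates_on (insert u (insert v I2)) hs"
    "\<forall>x \<rho> i. i \<notin> insert v I2 \<longrightarrow> exec x hs \<rho> i = \<rho> i"
    "\<forall>x \<rho> \<rho>'. (\<forall>i\<in>I2. \<rho> i = \<rho>' i) \<longrightarrow> g2 x \<rho> = g2 x \<rho>'"
    "\<forall>x \<rho>. exec x hs \<rho> v = ((\<rho> v \<noteq> (\<rho> u \<and> tree_eval x T)) \<noteq> g2 x \<rho>)"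
    by (rule sweepE) (rule that; assumption)
  note h = h'[rule_format]
  let ?garb = "\<lambda>x \<rho>. (g1 x \<rho> \<noteq> g2 x \<rho>)"
  have "sweep (Plus S T) u v I (gs @ hs)"
    unfolding sweep_def
  proof (intro conjI exI[of _ ?garb] allI impI)
    show "map (snd \<circ> snd) (gs @ hs) = labels (Plus S T)" using g(1) h(1) by simp
    show "gates_on (insert u (insert v I)) (gs @ hs)"
      using g(2) h(2) I by (auto elim!: gates_on_mono)
    show "exec x (gs @ hs) \<rho> i = \<rho> i" if "i \<notin> insert v I" for x \<rho> i
    proof -
      have "i \<notin> insert v I2" "i \<notin> insert v I1" using that I by auto
      then show ?thesis using g(3) h(3) by simp
    qed
    show "?garb x \<rho> = ?garb x \<rho>'" if "\<forall>i\<in>I. \<rho> i = \<rho>' i" for x \<rho> \<rho>'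
      using that g(4)[of \<rho> \<rho>' x] h(4)[of \<rho> \<rho>' x] I by auto
    fix x \<rho>
    have "u \<notin> insert v I1" using I Plus.prems by auto
    then have u: "exec x gs \<rho> u = \<rho> u" by (rule g(3))
    have "g2 x (exec x gs \<rho>) = g2 x \<rho>"
    proof (rule h(4))
      fix i assume "i \<in> I2"
      then have "i \<notin> insert v I1" using I Plus.prems by auto
      then show "exec x gs \<rho> i = \<rho> i" by (rule g(3))
    qed
    then show "exec x (gs @ hs) \<rho> v = ((\<rho> v \<noteq> (\<rho> u \<and> tree_eval x (Plus S T))) \<noteq> ?garb x \<rho>)"
      unfolding exec_append h(5) u g(5) by auto
  qed
  then show ?case by blast
qed

text \<open>Sweep, copy the output register \<open>v\<close> into \<open>t\<close>, and undo the sweep; doing this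
  for both contents of the source register \<open>w\<close> cancels the garbage.\<close>

lemma ex_clean_gates:
  assumes "length (labels T) + 3 \<le> R" "u < R" "t < R" "u \<noteq> t"
  shows "\<exists>gs. gates_on {..<R} gs \<and> set (map (snd \<circ> snd) gs) \<subseteq> insert one (set (labels T)) \<and>
    (\<forall>c :: 'l \<Rightarrow> real. (\<Sum>g\<leftarrow>gs. c (snd (snd g))) = 4 * (\<Sum>l\<leftarrow>labels T. c l) + 6 * c one) \<and>
    (\<forall>x \<rho>. x one \<longrightarrow> exec x gs \<rho> = \<rho>(t := (\<rho> t \<noteq> (\<rho> u \<and> tree_eval x T))))"
proof -
  have "card ({..<R} - {u, t}) = R - 2" using assms by (subst card_Diff_subset) auto
  then have "2 \<le> card ({..<R} - {u, t})" using assms(1) labels_pos[of T] by simp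
  then obtain B where "B \<subseteq> {..<R} - {u, t}" "card B = 2"
    using obtain_subset_with_card_n by metis
  then obtain w v where wv: "w < R" "v < R" "w \<noteq> v" "w \<notin> {u, t}" "v \<notin> {u, t}"
    by (auto simp: card_2_iff)
  \<comment> \<open>Next to \<open>u\<close>, \<open>t\<close>, \<open>w\<close> and
    \<open>v\<close> the sweep needs one register less than there are leaves, which explains the
    bound by the number of leaves plus 3.\<close>
  define I where "I = {..<R} - {u, t, w, v}"
  have "card I = R - 4" unfolding I_def using assms wv by (subst card_Diff_subset) auto
  then have "length (labels T) \<le> Suc (card I)" using assms(1) labels_pos[of T] by simp
  moreover have "finite I" "w \<notin> I" "v \<notin> I" by (simp_all add: I_def)
  ultimately obtain X where X: "sweep T w v I X"
    using ex_sweep[of I T w v] wv(3) by blast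
  then obtain garb where lab: "map (snd \<circ> snd) X = labels T" and on: "gates_on (insert w (insert v I)) X"
    and "\<forall>x \<rho> i. i \<notin> insert v I \<longrightarrow> exec x X \<rho> i = \<rho> i"
    and garb': "\<forall>x \<rho> \<rho>'. (\<forall>i\<in>I. \<rho> i = \<rho>' i) \<longrightarrow> garb x \<rho> = garb x \<rho>'"
    and ev': "\<forall>x \<rho>. exec x X \<rho> v = ((\<rho> v \<noteq> (\<rho> w \<and> tree_eval x T)) \<noteq> garb x \<rho>)"
    by (rule sweepE) (rule that; assumption)
  note garb = garb'[rule_format] and ev = ev'[rule_format]
  \<comment> \<open>The two copies add \<open>v\<close> after the sweep and \<open>v\<close> before
    it, so \<open>Y\<close> adds \<open>w * T + garb\<close> to \<open>t\<close> and restores all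
    other registers.\<close>
  define Y where "Y = X @ [(v, t, one)] @ rev X @ [(v, t, one)]"
  \<comment> \<open>Between the two rounds \<open>w\<close> becomes \<open>w + u\<close>, while
    \<open>garb\<close> is unchanged since \<open>w\<close> is not in \<open>I\<close>. The two
    contributions add up to \<open>u * T\<close>, and the last gate restores \<open>w\<close>. The
    sweep occurs four times, the label \<open>one\<close> six times.\<close>
  define gs where "gs = Y @ [(u, w, one)] @ Y @ [(u, w, one)]"
  have onR: "gates_on {..<R} X" using on wv by (rule_tac gates_on_mono) (auto simp: I_def)
  have t: "t \<notin> insert w (insert v I)" using wv by (auto simp: I_def)
  have comm: "exec x (rev X) (\<rho>(t := b)) = (exec x (rev X) \<rho>)(t := b)" for x \<rho> b
  proof -
    have "exec x gs (\<rho>(t := b)) = (exec x gs \<rho>)(t := b)" if "gates_on (insert w (insert v I)) gs" for gs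
      using that t
    proof (induction gs arbitrary: \<rho>)
      case (Cons g gs)
      obtain a b' l where g: "g = (a, b', l)" by (cases g)
      then have "a \<noteq> t" "b' \<noteq> t" using Cons.prems by auto
      then have "add_prod x a b' l (\<rho>(t := b)) = (add_prod x a b' l \<rho>)(t := b)"
        by (auto simp: add_prod_def fun_eq_iff)
      moreover have "gates_on (insert w (insert v I)) gs" using Cons.prems g by simp
      then have "exec x gs (\<rho>'(t := b)) = (exec x gs \<rho>')(t := b)" for \<rho>'
        using Cons.IH t by blast
      ultimately show ?case by (simp only: g exec.simps)
    qed simp
    then show ?thesis using on by simp
  qed
  have copy: "add_prod x a b one \<rho> = \<rho>(b := (\<rho> b \<noteq> \<rho> a))" if "x one" for x a b \<rho>
    using that by (simp add: add_prod_def)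
  have Y: "exec x Y \<rho> = \<rho>(t := (\<rho> t \<noteq> ((\<rho> w \<and> tree_eval x T) \<noteq> garb x \<rho>)))" if "x one" for x \<rho>
  proof -
    have Xt: "exec x X \<rho> t = \<rho> t" by (rule exec_outside[OF on t])
    have vt: "(v = t) = False" using wv by auto
    have "exec x Y \<rho> = \<rho>(t := ((\<rho> t \<noteq> exec x X \<rho> v) \<noteq> \<rho> v))"
      by (simp only: Y_def exec_append exec.simps copy[of x, OF that] comm exec_rev[OF on] Xt
          fun_upd_apply fun_upd_upd vt if_False refl if_True)
    also have "((\<rho> t \<noteq> exec x X \<rho> v) \<noteq> \<rho> v) = (\<rho> t \<noteq> ((\<rho> w \<and> tree_eval x T) \<noteq> garb x \<rho>))"
      unfolding ev by blast
    finally show ?thesis .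
  qed
  have "exec x gs \<rho> = \<rho>(t := (\<rho> t \<noteq> (\<rho> u \<and> tree_eval x T)))" if "x one" for x \<rho>
  proof -
    define \<rho>1 where "\<rho>1 = exec x Y \<rho>"
    define \<rho>2 where "\<rho>2 = \<rho>1(w := (\<rho>1 w \<noteq> \<rho>1 u))"
    define \<rho>3 where "\<rho>3 = exec x Y \<rho>2"
    have final: "exec x gs \<rho> = \<rho>3(w := (\<rho>3 w \<noteq> \<rho>3 u))"
      unfolding \<rho>1_def \<rho>2_def \<rho>3_def gs_def by (simp only: exec_append exec.simps copy[of x, OF that])
    have ne: "w \<noteq> t" "w \<noteq> u" "u \<noteq> t" using wv assms(4) by auto
    have r1: "\<rho>1 i = \<rho> i" if "i \<noteq> t" for i using that \<open>x one\<close> by (simp add: \<rho>1_def Y)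
    have r1t: "\<rho>1 t = (\<rho> t \<noteq> ((\<rho> w \<and> tree_eval x T) \<noteq> garb x \<rho>))"
      using that by (simp only: \<rho>1_def Y fun_upd_same)
    have r2: "\<rho>2 i = \<rho>1 i" if "i \<noteq> w" for i using that by (simp add: \<rho>2_def)
    have r2w: "\<rho>2 w = (\<rho> w \<noteq> \<rho> u)" using ne by (simp add: \<rho>2_def r1)
    have r3: "\<rho>3 i = \<rho>2 i" if "i \<noteq> t" for i using that \<open>x one\<close> by (simp add: \<rho>3_def Y)
    have "\<rho>2 i = \<rho> i" if "i \<in> I" for i
    proof -
      have "i \<noteq> w" "i \<noteq> t" using that by (auto simp: I_def)
      then show ?thesis by (simp add: r1 r2)
    qed
    then have "garb x \<rho>2 = garb x \<rho>" by (rule garb)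
    then have r3t: "\<rho>3 t = (\<rho>2 t \<noteq> ((\<rho>2 w \<and> tree_eval x T) \<noteq> garb x \<rho>))"
      using that by (simp only: \<rho>3_def Y fun_upd_same)
    have "\<rho>3 t = (\<rho> t \<noteq> (\<rho> u \<and> tree_eval x T))"
      unfolding r3t r2w r2[OF ne(1)[symmetric]] r1t by blast
    then show ?thesis
      unfolding final using ne by (auto simp: fun_eq_iff r1 r2 r2w r3)
  qed
  moreover have "gates_on {..<R} gs" unfolding gs_def Y_def using onR assms wv by auto
  moreover have "set (map (snd \<circ> snd) gs) \<subseteq> insert one (set (labels T))"
    unfolding gs_def Y_def lab[symmetric] by auto
  moreover have "(\<Sum>g\<leftarrow>gs. c (snd (snd g))) = 4 * (\<Sum>l\<leftarrow>labels T. c l) + 6 * c one"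
    for c :: "'l \<Rightarrow> real"
  proof -
    have "(\<Sum>g\<leftarrow>X. c (snd (snd g))) = (\<Sum>l\<leftarrow>labels T. c l)"
      unfolding lab[symmetric] by (simp add: comp_def)
    moreover have "(\<Sum>g\<leftarrow>rev X. c (snd (snd g))) = (\<Sum>g\<leftarrow>X. c (snd (snd g)))"
      by (simp add: rev_map[symmetric])
    ultimately show ?thesis unfolding gs_def Y_def by simp
  qed
  ultimately show ?thesis by blast
qed

section \<open>Balancing formulas\<close>

text \<open>Since any source and target are allowed and the other registers may hold anything, such
  a gate list can stand in for a single gate of a larger list. All levels of nesting share the same
  \<open>R\<close> registers.\<close>

definition implements ::
    "nat \<Rightarrow> ('l \<Rightarrow> input \<Rightarrow> bool) \<Rightarrow> ('l \<Rightarrow> real) \<Rightarrow> 'l set \<Rightarrow> (input \<Rightarrow> bool) \<Rightarrow> real \<Rightarrow> bool" where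
  "implements R val c G f x \<longleftrightarrow> (\<forall>u t. u < R \<longrightarrow> t < R \<longrightarrow> u \<noteq> t \<longrightarrow>
     (\<exists>gs. gates_on {..<R} gs \<and> set (map (snd \<circ> snd) gs) \<subseteq> G \<and> (\<Sum>g\<leftarrow>gs. c (snd (snd g))) \<le> x \<and>
       (\<forall>z. exec (\<lambda>l. val l z) gs = add_prod (\<lambda>_. f z) u t ())))"

lemma implements_mono: "implements R val c G f x \<Longrightarrow> x \<le> y \<Longrightarrow> implements R val c G f y"
  unfolding implements_def by (meson order_trans)

lemma implements_leaf: "l \<in> G \<Longrightarrow> implements R val c G (val l) (c l)"
  unfolding implements_def
proof (intro allI impI)
  fix u t assume "l \<in> G" "u < R" "t < R" "u \<noteq> t"
  then show "\<exists>gs. gates_on {..<R} gs \<and> set (map (snd \<circ> snd) gs) \<subseteq> G \<and>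
      (\<Sum>g\<leftarrow>gs. c (snd (snd g))) \<le> c l \<and>
      (\<forall>z. exec (\<lambda>l. val l z) gs = add_prod (\<lambda>_. val l z) u t ())"
    by (intro exI[of _ "[(u, t, l)]"]) (auto simp: fun_eq_iff add_prod_def)
qed

lemma labels_map_tree: "labels (map_tree h T) = map h (labels T)"
  by (induction T) auto

lemma tree_eval_map_tree: "tree_eval v (map_tree h T) = tree_eval (v \<circ> h) T"
  by (induction T) auto

lemma implements_gates:
  assumes "gates_on {..<R} gs" "\<And>p. p \<in> set (map (snd \<circ> snd) gs) \<Longrightarrow> implements R val c G (val' p) (x p)"
  shows "\<exists>hs. gates_on {..<R} hs \<and> set (map (snd \<circ> snd) hs) \<subseteq> G \<and>
    (\<Sum>g\<leftarrow>hs. c (snd (snd g))) \<le> (\<Sum>g\<leftarrow>gs. x (snd (snd g))) \<and>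
    (\<forall>z. exec (\<lambda>l. val l z) hs = exec (\<lambda>p. val' p z) gs)"
  using assms
proof (induction gs)
  case Nil
  then show ?case by (intro exI[of _ "[]"]) auto
next
  case (Cons g gs)
  obtain u t p where g: "g = (u, t, p)" by (cases g)
  obtain hs where hs: "gates_on {..<R} hs" "set (map (snd \<circ> snd) hs) \<subseteq> G"
    "(\<Sum>g\<leftarrow>hs. c (snd (snd g))) \<le> (\<Sum>g\<leftarrow>gs. x (snd (snd g)))"
    "\<And>z. exec (\<lambda>l. val l z) hs = exec (\<lambda>p. val' p z) gs"
    using Cons g by auto
  have "u < R" "t < R" "u \<noteq> t" "implements R val c G (val' p) (x p)" using Cons.prems g by auto
  then obtain js where js: "gates_on {..<R} js" "set (map (snd \<circ> snd) js) \<subseteq> G"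
    "(\<Sum>g\<leftarrow>js. c (snd (snd g))) \<le> x p"
    "\<And>z. exec (\<lambda>l. val l z) js = add_prod (\<lambda>_. val' p z) u t ()"
    unfolding implements_def by metis
  have "exec (\<lambda>l. val l z) (js @ hs) = exec (\<lambda>p. val' p z) (g # gs)" for z
    by (rule ext) (simp add: js(4) hs(4) g add_prod_def)
  then show ?case using js hs g by (intro exI[of _ "js @ hs"]) auto
qed

text \<open>A label of \<open>T\<close> may itself be a composite function. Expanding its gates
  within the same registers makes the list longer but needs no new registers.\<close>

lemma implements_tree_eval:
  assumes p: "\<And>p. p \<in> set (labels T) \<Longrightarrow> implements R val c G (val' p) (x p)"
    and one: "one \<in> G" "\<And>z. val one z" and R: "length (labels T) + 3 \<le> R"
  shows "implements R val c G (\<lambda>z. tree_eval (\<lambda>p. val' p z) T) (4 * (\<Sum>p\<leftarrow>labels T. x p) + 6 * c one)"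
  unfolding implements_def
proof (intro allI impI)
  fix u t assume ut: "u < R" "t < R" "u \<noteq> t"
  \<comment> \<open>\<open>None\<close> represents the constant one, which comes from the label type
    of the final gates and not from that of \<open>T\<close>.\<close>
  let ?T = "map_tree Some T" and ?x = "case_option (c one) x" and ?v = "case_option (\<lambda>_. True) val'"
  have "length (labels ?T) + 3 \<le> R" using R by (simp add: labels_map_tree)
  from ex_clean_gates[OF this ut, of None] obtain gs where gs: "gates_on {..<R} gs"
    "set (map (snd \<circ> snd) gs) \<subseteq> insert None (set (labels ?T))"
    "(\<Sum>g\<leftarrow>gs. ?x (snd (snd g))) = 4 * (\<Sum>l\<leftarrow>labels ?T. ?x l) + 6 * ?x None"
    "\<And>v \<rho>. v None \<Longrightarrow> exec v gs \<rho> = \<rho>(t := (\<rho> t \<noteq> (\<rho> u \<and> tree_eval v ?T)))" by blast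
  have none: "implements R val c G (\<lambda>_. True) (c one)"
    using implements_leaf[of one G R val c] one by (metis (full_types) ext)
  have "implements R val c G (?v q) (?x q)" if "q \<in> set (map (snd \<circ> snd) gs)" for q
  proof (cases q)
    case (Some p)
    then have "p \<in> set (labels T)" using that gs(2) by (auto simp: labels_map_tree)
    then show ?thesis using p Some by simp
  qed (simp add: none)
  from implements_gates[where x = ?x and val' = ?v, OF gs(1) this] obtain hs where hs: "gates_on {..<R} hs"
    "set (map (snd \<circ> snd) hs) \<subseteq> G"
    "(\<Sum>g\<leftarrow>hs. c (snd (snd g))) \<le> (\<Sum>g\<leftarrow>gs. ?x (snd (snd g)))"
    "\<And>z. exec (\<lambda>l. val l z) hs = exec (\<lambda>p. ?v p z) gs" by blast
  have "exec (\<lambda>l. val l z) hs = add_prod (\<lambda>_. tree_eval (\<lambda>p. val' p z) T) u t ()" for z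
    unfolding hs(4) by (intro ext) (simp add: gs(4) add_prod_def tree_eval_map_tree comp_def)
  moreover have "(\<Sum>g\<leftarrow>hs. c (snd (snd g))) \<le> 4 * (\<Sum>p\<leftarrow>labels T. x p) + 6 * c one"
    using hs(3) gs(3) by (simp add: labels_map_tree comp_def)
  ultimately show "\<exists>gs. gates_on {..<R} gs \<and> set (map (snd \<circ> snd) gs) \<subseteq> G \<and>
       (\<Sum>g\<leftarrow>gs. c (snd (snd g))) \<le> 4 * (\<Sum>p\<leftarrow>labels T. x p) + 6 * c one \<and>
       (\<forall>z. exec (\<lambda>l. val l z) gs = add_prod (\<lambda>_. tree_eval (\<lambda>p. val' p z) T) u t ())"
    using hs(1,2) by blast
qed

definition weight :: "bform tree \<Rightarrow> nat" where
  "weight F = (\<Sum>l\<leftarrow>labels F. leaves l)"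

abbreviation ev :: "input \<Rightarrow> bform tree \<Rightarrow> bool" where
  "ev z \<equiv> tree_eval (eval z)"

lemma weight_simps [simp]:
  "weight (Leaf l) = leaves l"
  "weight (Conj F G) = weight F + weight G"
  "weight (Plus F G) = weight F + weight G"
  by (simp_all add: weight_def)

text \<open>\<open>F = A * T + B\<close>, where \<open>A\<close> and \<open>B\<close> collect the light subtrees met since the last
  heavy node on the path; a run of light operations acts on the heavy value as an affine map.\<close>

definition decomposition ::
    "nat \<Rightarrow> bform tree \<Rightarrow> bform tree \<Rightarrow> bform tree \<Rightarrow> bform tree tree \<Rightarrow> nat \<Rightarrow> bool" where
  "decomposition \<tau> F A B T \<omega> \<longleftrightarrow>
     (\<forall>z. ev z F = ((ev z A \<and> tree_eval (ev z) T) \<noteq> ev z B)) \<and>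
     \<omega> \<le> \<tau> \<and> weight A \<le> \<omega> + 1 \<and> weight B \<le> \<omega> + 1 \<and>
     (\<Sum>p\<leftarrow>labels T. weight p) + 2 * \<omega> \<le> 2 * weight F + length (labels T) \<and>
     length (labels T) * \<tau> + 4 * \<tau> + 2 * \<omega> \<le> 6 * weight F \<and>
     (\<forall>p\<in>set (labels T). weight p \<le> \<tau> + 1 \<or> (\<exists>l\<in>set (labels F). p = Leaf l)) \<and>
     (\<forall>p\<in>insert A (insert B (set (labels T))).
        set (labels p) \<subseteq> set (labels F) \<union> {Const True, Const False})"

text \<open>Turns the pending affine map into a part of the skeleton, at the price of two more
  pieces.\<close>

definition close :: "bform tree \<Rightarrow> bform tree tree \<Rightarrow> bform tree \<Rightarrow> bform tree tree" where
  "close A T B = Plus (Conj (Leaf A) T) (Leaf B)"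

lemma close_simps [simp]:
  "labels (close A T B) = A # labels T @ [B]"
  "tree_eval v (close A T B) = ((v A \<and> tree_eval v T) \<noteq> v B)"
  by (simp_all add: close_def)

text \<open>As long as the collected weight stays within \<open>\<tau>\<close>, the light
  \<open>H\<close> is absorbed: \<open>A * T + B\<close> becomes \<open>A * H * T + B * H\<close> or
  \<open>A * T + (B + H)\<close>. A product duplicates \<open>H\<close>, hence the factor 2 in the
  bound on the total weight. Otherwise the map is closed and \<open>H\<close> opens a new one; the
  two pieces added are paid for by \<open>\<omega> + weight H > \<tau>\<close>.\<close>

lemma decomposition_light:
  assumes G: "decomposition \<tau> G A B T \<omega>" and H: "weight H \<le> \<tau>"
    and w: "weight F = weight G + weight H" and l: "set (labels F) = set (labels G) \<union> set (labels H)"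
    and ev: "(\<forall>z. ev z F = (ev z G \<and> ev z H)) \<or> (\<forall>z. ev z F = (ev z G \<noteq> ev z H))"
  shows "\<exists>A B T \<omega>. decomposition \<tau> F A B T \<omega>"
proof -
  note G = G[unfolded decomposition_def]
  show ?thesis
  proof (cases "\<omega> + weight H \<le> \<tau>")
    case True
    from ev show ?thesis
    proof
      assume "\<forall>z. ev z F = (ev z G \<and> ev z H)"
      then have "decomposition \<tau> F (Conj A H) (Conj B H) T (\<omega> + weight H)"
        unfolding decomposition_def using G True by (auto simp: w l)
      then show ?thesis by blast
    next
      assume "\<forall>z. ev z F = (ev z G \<noteq> ev z H)"
      then have "decomposition \<tau> F A (Plus B H) T (\<omega> + weight H)"
        unfolding decomposition_def using G True by (auto simp: w l)
      then show ?thesis by blast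
    qed
  next
    case False
    from ev show ?thesis
    proof
      assume "\<forall>z. ev z F = (ev z G \<and> ev z H)"
      then have "decomposition \<tau> F H (Leaf (Const False)) (close A T B) (weight H)"
        unfolding decomposition_def using G H False by (auto simp: w l)
      then show ?thesis by blast
    next
      assume "\<forall>z. ev z F = (ev z G \<noteq> ev z H)"
      then have "decomposition \<tau> F (Leaf (Const True)) H (close A T B) (weight H)"
        unfolding decomposition_def using G H False by (auto simp: w l)
      then show ?thesis by blast
    qed
  qed
qed

text \<open>Closing both maps adds four pieces. Each operand has a reserve of
  \<open>4 * \<tau>\<close> in the bound on the number of pieces, and the result has to keep only
  one of the two reserves.\<close>

lemma decomposition_heavy:
  assumes G: "decomposition \<tau> G A B T \<omega>" and H: "decomposition \<tau> H A' B' T' \<omega>'"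
    and w: "weight F = weight G + weight H" and l: "set (labels F) = set (labels G) \<union> set (labels H)"
    and ev: "(\<forall>z. ev z F = (ev z G \<and> ev z H)) \<or> (\<forall>z. ev z F = (ev z G \<noteq> ev z H))"
  shows "\<exists>A B T \<omega>. decomposition \<tau> F A B T \<omega>"
proof -
  note G = G[unfolded decomposition_def] and H = H[unfolded decomposition_def]
  let ?A = "Leaf (Const True)" and ?B = "Leaf (Const False)"
  let ?S = "close A T B" and ?S' = "close A' T' B'"
  from ev show ?thesis
  proof
    assume "\<forall>z. ev z F = (ev z G \<and> ev z H)"
    then have "decomposition \<tau> F ?A ?B (Conj ?S ?S') 0"
      unfolding decomposition_def using G H by (auto simp: w l add_mult_distrib)
    then show ?thesis by blast
  next
    assume "\<forall>z. ev z F = (ev z G \<noteq> ev z H)"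
    then have "decomposition \<tau> F ?A ?B (Plus ?S ?S') 0"
      unfolding decomposition_def using G H by (auto simp: w l add_mult_distrib)
    then show ?thesis by blast
  qed
qed

text \<open>A skeleton begins with two pieces; together with the reserve this amounts to
  \<open>6 * \<tau>\<close>, which is below \<open>6 * weight F\<close>.\<close>

lemma decomposition_two_light:
  assumes "weight G \<le> \<tau>" "weight H \<le> \<tau>" "\<tau> < weight F"
    and w: "weight F = weight G + weight H" and l: "set (labels F) = set (labels G) \<union> set (labels H)"
    and ev: "(\<forall>z. ev z F = (ev z G \<and> ev z H)) \<or> (\<forall>z. ev z F = (ev z G \<noteq> ev z H))"
  shows "\<exists>A B T \<omega>. decomposition \<tau> F A B T \<omega>"
proof -
  let ?A = "Leaf (Const True)" and ?B = "Leaf (Const False)"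
  from ev show ?thesis
  proof
    assume "\<forall>z. ev z F = (ev z G \<and> ev z H)"
    then have "decomposition \<tau> F ?A ?B (Conj (Leaf G) (Leaf H)) 0"
      unfolding decomposition_def using assms(1-3) by (auto simp: w l)
    then show ?thesis by blast
  next
    assume "\<forall>z. ev z F = (ev z G \<noteq> ev z H)"
    then have "decomposition \<tau> F ?A ?B (Plus (Leaf G) (Leaf H)) 0"
      unfolding decomposition_def using assms(1-3) by (auto simp: w l)
    then show ?thesis by blast
  qed
qed

lemma decomposition_step:
  assumes "\<tau> < weight G \<Longrightarrow> \<exists>A B T \<omega>. decomposition \<tau> G A B T \<omega>"
    "\<tau> < weight H \<Longrightarrow> \<exists>A B T \<omega>. decomposition \<tau> H A B T \<omega>" "\<tau> < weight F"
    and w: "weight F = weight G + weight H" and l: "set (labels F) = set (labels G) \<union> set (labels H)"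
    and ev: "(\<forall>z. ev z F = (ev z G \<and> ev z H)) \<or> (\<forall>z. ev z F = (ev z G \<noteq> ev z H))"
  shows "\<exists>A B T \<omega>. decomposition \<tau> F A B T \<omega>"
proof (cases "\<tau> < weight G"; cases "\<tau> < weight H")
  assume "\<tau> < weight G" "\<tau> < weight H"
  then show ?thesis using assms(1,2) decomposition_heavy[OF _ _ w l ev] by blast
next
  assume "\<tau> < weight G" "\<not> \<tau> < weight H"
  then show ?thesis using assms(1) decomposition_light[OF _ _ w l ev] by force
next
  assume *: "\<not> \<tau> < weight G" "\<tau> < weight H"
  have "weight F = weight H + weight G" "set (labels F) = set (labels H) \<union> set (labels G)"
    "(\<forall>z. ev z F = (ev z H \<and> ev z G)) \<or> (\<forall>z. ev z F = (ev z H \<noteq> ev z G))"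
    using w l ev by auto
  from decomposition_light[OF _ _ this] show ?thesis using assms(2) * by force
next
  assume "\<not> \<tau> < weight G" "\<not> \<tau> < weight H"
  then show ?thesis using decomposition_two_light[OF _ _ assms(3) w l ev] by simp
qed

lemma ex_decomposition: "\<tau> < weight F \<Longrightarrow> \<exists>A B T \<omega>. decomposition \<tau> F A B T \<omega>"
proof (induction F)
  case (Leaf l)
  \<comment> \<open>An atom is never cut, however heavy it is; it forms a piece of its own.\<close>
  then have "decomposition \<tau> (Leaf l) (Leaf (Const True)) (Leaf (Const False)) (Leaf (Leaf l)) 0"
    unfolding decomposition_def by auto
  then show ?case by blast
next
  case (Conj G H)
  show ?case by (rule decomposition_step[OF Conj.IH Conj.prems]) auto
next
  case (Plus G H)
  show ?case by (rule decomposition_step[OF Plus.IH Plus.prems]) auto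
qed

section \<open>Cost of the recursive evaluation\<close>

lemma of_nat_sum_list_map: "of_nat (\<Sum>x\<leftarrow>xs. f x) = (\<Sum>x\<leftarrow>xs. of_nat (f x) :: real)"
  by (induction xs) auto

lemma powr_one_plus: "0 \<le> (x::real) \<Longrightarrow> x powr (1 + \<epsilon>) = x * x powr \<epsilon>"
  by (cases "x = 0") (simp_all add: powr_add)

text \<open>One level of the recursion uses pieces of total weight at most \<open>8 * s\<close>,
  each four times, and the constant one six times. Pieces of weight at most \<open>2 * s / K\<close>
  gain a factor 1/64 in \<open>s powr \<epsilon>\<close>, so the constant has to satisfy
  \<open>32 * (1 + x / 64) + 6 \<le> x\<close>, with equality for 76.\<close>

lemma implements_ev:
  fixes K R :: nat and c :: "bform \<Rightarrow> real"
  assumes \<epsilon>: "0 < \<epsilon>" and K: "3 \<le> K" "(2 / real K) powr \<epsilon> \<le> 1 / 64" and R: "12 * K + 3 \<le> R"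
    and G: "Const True \<in> G" "Const False \<in> G" "\<And>l. l \<in> G \<Longrightarrow> 1 \<le> leaves l"
    and c: "0 \<le> c0" "\<And>l. l \<in> G \<Longrightarrow> c l \<le> c0 * real (leaves l) powr (1 + \<epsilon>)"
  shows "set (labels F) \<subseteq> G \<Longrightarrow>
    implements R (\<lambda>l z. eval z l) c G (\<lambda>z. ev z F) (76 * c0 * real (weight F) powr (1 + \<epsilon>))"
proof (induction F rule: measure_induct_rule[of weight])
  case (less F)
  define s where "s = weight F"
  have labF: "set (labels F) \<subseteq> G" by (rule less.prems)
  have len: "length xs \<le> (\<Sum>l\<leftarrow>xs. leaves l)" if "set xs \<subseteq> G" for xs
    using that
  proof (induction xs)
    case (Cons l xs)
    then show ?case using G(3)[of l] by simp
  qed simp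
  have lens: "length (labels F) \<le> s" using len[OF labF] by (simp add: s_def weight_def)
  have "1 \<le> s" using labels_pos[of F] lens by linarith
  then have s1: "1 \<le> real s powr \<epsilon>" "1 \<le> real s" using \<epsilon> by (simp_all add: ge_one_powr_ge_zero)
  have s2: "1 \<le> real s * real s powr \<epsilon>" using mult_mono[of 1 "real s" 1 "real s powr \<epsilon>"] s1 by simp
  have ct: "c (Const True) \<le> c0" using c(2)[OF G(1)] by simp
  have lab_le: "leaves l \<le> s" if "l \<in> set (labels F)" for l
    unfolding s_def weight_def by (rule member_le_sum_list) (use that in auto)
  have cl: "c l \<le> c0 * real s powr \<epsilon> * real (leaves l)" if "l \<in> set (labels F)" for l
  proof -
    have "c l \<le> c0 * (real (leaves l) * real (leaves l) powr \<epsilon>)"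
      using c(2)[of l] that labF by (auto simp: powr_one_plus)
    also have "\<dots> \<le> c0 * (real (leaves l) * real s powr \<epsilon>)"
      using lab_le[OF that] c(1) \<epsilon> by (intro mult_left_mono powr_mono2) auto
    finally show ?thesis by (simp add: mult_ac)
  qed
  show ?case
  proof (cases "s < K")
    case True
    \<comment> \<open>A tree with fewer than \<open>K\<close> leaves fits into the registers without
      being cut.\<close>
    have "implements R (\<lambda>l z. eval z l) c G (\<lambda>z. ev z F) (4 * (\<Sum>l\<leftarrow>labels F. c l) + 6 * c (Const True))"
      using True lens R labF G(1)
      by (intro implements_tree_eval[where val' = "\<lambda>l z. eval z l"] implements_leaf[where val = "\<lambda>l z. eval z l"]) auto
    moreover have "4 * (\<Sum>l\<leftarrow>labels F. c l) + 6 * c (Const True) \<le> 76 * c0 * real (weight F) powr (1 + \<epsilon>)"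
    proof -
      have "(\<Sum>l\<leftarrow>labels F. c l) \<le> (\<Sum>l\<leftarrow>labels F. c0 * real s powr \<epsilon> * real (leaves l))"
        by (rule sum_list_mono) (rule cl)
      also have "\<dots> = c0 * real s powr \<epsilon> * real s"
        unfolding s_def weight_def by (simp add: sum_list_const_mult of_nat_sum_list_map)
      finally have "(\<Sum>l\<leftarrow>labels F. c l) \<le> c0 * (real s * real s powr \<epsilon>)" by (simp add: mult_ac)
      moreover have "c0 \<le> c0 * (real s * real s powr \<epsilon>)" using mult_left_mono[OF s2 c(1)] by simp
      ultimately show ?thesis using ct c(1) unfolding s_def[symmetric] powr_one_plus[OF of_nat_0_le_iff]
        by linarith
    qed
    ultimately show ?thesis by (rule implements_mono)
  next
    case False
    define \<tau> where "\<tau> = s div K"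
    have \<tau>: "1 \<le> \<tau>" "\<tau> * K \<le> s" "s < (\<tau> + 1) * K"
      using False K(1) div_greater_zero_iff[of s K] dividend_less_div_times[of K s]
      by (auto simp: \<tau>_def algebra_simps)
    have "3 * \<tau> \<le> s" using mult_le_mono2[OF K(1), of \<tau>] \<tau>(2) by linarith
    then have "\<tau> < weight F" "\<tau> + 1 < s" using \<tau>(1) False K(1) unfolding s_def by linarith+
    then obtain A B T \<omega> where D: "decomposition \<tau> F A B T \<omega>" using ex_decomposition by blast
    note D = D[unfolded decomposition_def, folded s_def]
    let ?T = "close A T B" and ?m = "length (labels T)"
    define \<delta> where "\<delta> = (2 / real K) powr \<epsilon>"
    \<comment> \<open>A price per unit of weight that covers both kinds of pieces: an atom costs at
      most \<open>c0 * s powr \<epsilon>\<close> per leaf, and a light piece, by induction,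
      \<open>76 * \<delta>\<close> times as much.\<close>
    define y where "y = c0 * real s powr \<epsilon> * (1 + 76 * \<delta>)"
    have \<delta>: "0 \<le> \<delta>" "\<delta> \<le> 1 / 64" using K(2) by (simp_all add: \<delta>_def)
    have y0: "c0 * real s powr \<epsilon> \<le> y" "76 * c0 * real s powr \<epsilon> * \<delta> \<le> y"
      using c(1) \<delta> by (simp_all add: y_def algebra_simps)
    \<comment> \<open>The number of pieces is bounded in terms of \<open>K\<close> alone, since
      \<open>s\<close> is less than \<open>2 * K * \<tau>\<close>; this is why a fixed
      \<open>R\<close> suffices on all levels.\<close>
    have "?m * \<tau> + 4 * \<tau> \<le> 6 * s" using D by linarith
    also have "6 * s \<le> 12 * K * \<tau>"
    proof -
      have "K \<le> K * \<tau>" using \<tau>(1) by simp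
      moreover have "s < K + K * \<tau>" using \<tau>(3) by (simp add: algebra_simps)
      moreover have "12 * K * \<tau> = 12 * (K * \<tau>)" by simp
      ultimately show ?thesis by linarith
    qed
    finally have "(?m + 4) * \<tau> \<le> 12 * K * \<tau>" by (simp add: algebra_simps)
    then have m: "?m + 4 \<le> 12 * K" using \<tau>(1) by simp
    have "?m + 4 \<le> (?m + 4) * \<tau>" using \<tau>(1) by simp
    moreover have "(?m + 4) * \<tau> \<le> 6 * s" using D by (simp add: algebra_simps)
    ultimately have "?m + 4 \<le> 6 * s" by (rule order_trans)
    moreover have "(\<Sum>p\<leftarrow>labels T. weight p) + 2 * \<omega> \<le> 2 * s + ?m" "weight A \<le> \<omega> + 1" "weight B \<le> \<omega> + 1"
      using D by blast+
    ultimately have W: "(\<Sum>p\<leftarrow>labels ?T. weight p) \<le> 8 * s" by simp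
    have "implements R (\<lambda>l z. eval z l) c G (\<lambda>z. ev z p) (y * real (weight p))" if p: "p \<in> set (labels ?T)" for p
    proof -
      have "weight p \<le> \<tau> + 1 \<or> (\<exists>l\<in>set (labels F). p = Leaf l)"
        using D p by auto
      then show ?thesis
      proof
        assume "\<exists>l\<in>set (labels F). p = Leaf l"
        then obtain l where l: "l \<in> set (labels F)" "p = Leaf l" by blast
        have "implements R (\<lambda>l z. eval z l) c G (\<lambda>z. eval z l) (c l)"
          using implements_leaf[of l G R "\<lambda>l z. eval z l" c] l labF by blast
        moreover have "c l \<le> y * real (leaves l)"
          using cl[OF l(1)] mult_right_mono[OF y0(1), of "real (leaves l)"] by simp
        ultimately show ?thesis using l(2) implements_mono by simp
      next
        assume w: "weight p \<le> \<tau> + 1"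
        then have "weight p < weight F" using \<open>\<tau> + 1 < s\<close> by (simp add: s_def)
        moreover have "p \<in> insert A (insert B (set (labels T)))" using p by auto
        then have "set (labels p) \<subseteq> set (labels F) \<union> {Const True, Const False}" using D by blast
        then have "set (labels p) \<subseteq> G" using G(1,2) labF by blast
        ultimately have "implements R (\<lambda>l z. eval z l) c G (\<lambda>z. ev z p) (76 * c0 * real (weight p) powr (1 + \<epsilon>))"
          by (rule less.IH)
        moreover have "76 * c0 * real (weight p) powr (1 + \<epsilon>) \<le> y * real (weight p)"
        proof -
          \<comment> \<open>\<open>K * (\<tau> + 1)\<close> is at most \<open>s + K\<close>, and
            here \<open>K \<le> s\<close>.\<close>
          have "K * weight p \<le> 2 * s"
            using mult_le_mono2[OF w, of K] \<tau>(2) False by (simp add: algebra_simps)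
          then have "real K * real (weight p) \<le> 2 * real s"
            by (metis of_nat_le_iff of_nat_mult of_nat_numeral)
          then have "real (weight p) \<le> 2 / real K * real s"
            using K(1) by (simp add: field_simps)
          then have "real (weight p) powr \<epsilon> \<le> (2 / real K * real s) powr \<epsilon>"
            using \<epsilon> by (intro powr_mono2) auto
          also have "\<dots> = \<delta> * real s powr \<epsilon>" by (simp only: \<delta>_def powr_mult)
          finally have "76 * c0 * real (weight p) * real (weight p) powr \<epsilon> \<le>
              76 * c0 * real (weight p) * (\<delta> * real s powr \<epsilon>)"
            using c(1) by (intro mult_left_mono) auto
          also have "\<dots> = 76 * c0 * real s powr \<epsilon> * \<delta> * real (weight p)" by simp
          also have "\<dots> \<le> y * real (weight p)" using y0(2) by (intro mult_right_mono) auto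
          finally show ?thesis by (simp add: powr_one_plus mult_ac)
        qed
        ultimately show ?thesis by (rule implements_mono)
      qed
    qed
    then have "implements R (\<lambda>l z. eval z l) c G (\<lambda>z. tree_eval (\<lambda>p. ev z p) ?T)
        (4 * (\<Sum>p\<leftarrow>labels ?T. y * real (weight p)) + 6 * c (Const True))"
      using m R G(1) by (intro implements_tree_eval) auto
    moreover have "(\<lambda>z. tree_eval (\<lambda>p. ev z p) ?T) = (\<lambda>z. ev z F)" using D by auto
    moreover have "4 * (\<Sum>p\<leftarrow>labels ?T. y * real (weight p)) + 6 * c (Const True)
        \<le> 76 * c0 * real (weight F) powr (1 + \<epsilon>)"
    proof -
      have "(\<Sum>p\<leftarrow>labels ?T. y * real (weight p)) = y * real (\<Sum>p\<leftarrow>labels ?T. weight p)"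
        by (simp add: sum_list_const_mult of_nat_sum_list_map algebra_simps)
      also have "\<dots> \<le> y * real (8 * s)"
        using W y0(1) c(1) by (intro mult_left_mono) (auto intro: order_trans[rotated])
      also have "\<dots> = 8 * (c0 * (real s * real s powr \<epsilon>)) * (1 + 76 * \<delta>)" by (simp add: y_def)
      also have "\<dots> \<le> 8 * (c0 * (real s * real s powr \<epsilon>)) * (1 + 76 / 64)"
        using \<delta> c(1) by (intro mult_left_mono) auto
      finally have "(\<Sum>p\<leftarrow>labels ?T. y * real (weight p)) \<le> 17.5 * (c0 * (real s * real s powr \<epsilon>))"
        by simp
      moreover have "c0 \<le> c0 * (real s * real s powr \<epsilon>)" using mult_left_mono[OF s2 c(1)] by simp
      ultimately show ?thesis using ct unfolding s_def[symmetric] powr_one_plus[OF of_nat_0_le_iff]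
        by linarith
    qed
    ultimately show ?thesis by (simp add: implements_mono)
  qed
qed

section \<open>Programs from gate lists and counters\<close>

lemma card_bounded_registers:
  "finite {\<rho>::nat \<Rightarrow> bool. \<forall>i\<ge>R. \<not> \<rho> i}" "card {\<rho>::nat \<Rightarrow> bool. \<forall>i\<ge>R. \<not> \<rho> i} \<le> 2 ^ R"
proof -
  let ?X = "{\<rho>::nat \<Rightarrow> bool. \<forall>i\<ge>R. \<not> \<rho> i}"
  have i: "inj_on Collect ?X" by (rule inj_onI) auto
  have s: "Collect ` ?X \<subseteq> Pow {..<R}" by (auto simp: not_le[symmetric])
  show "finite ?X" using inj_on_finite[OF i s] by simp
  show "card ?X \<le> 2 ^ R" using card_inj_on_le[OF i s] by (simp add: card_Pow)
qed

text \<open>The state consists of the contents of the registers and one of the \<open>N\<close>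
  states in which the leaf programs run. The cost \<open>c l\<close> is the length of one addition
  controlled by the leaf \<open>l\<close>, as supplied by \<open>computes_apply\<close>.\<close>

lemma computes_implements:
  assumes f: "implements R val c G f x" and R: "2 \<le> R"
    and G: "\<And>l. l \<in> G \<Longrightarrow> computes A N (len l) (val l) \<and> c l = real (2 * len l + 1)"
    and x: "x \<le> real L" and N: "2 \<le> N"
  shows "computes A (2 ^ R * N) L f"
proof -
  let ?X = "{\<rho>::nat \<Rightarrow> bool. \<forall>i\<ge>R. \<not> \<rho> i}"
  have R01: "0 < R" "1 < R" "0 \<noteq> (1::nat)" using R by auto
  from f[unfolded implements_def, rule_format, OF R01]
  obtain gs where gs: "gates_on {..<R} gs" "set (map (snd \<circ> snd) gs) \<subseteq> G"
    "(\<Sum>g\<leftarrow>gs. c (snd (snd g))) \<le> x" "\<And>z. exec (\<lambda>l. val l z) gs = add_prod (\<lambda>_. f z) 0 1 ()"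
    by blast
  have "\<exists>ps. program A (?X \<times> {..<N}) ps \<and> real (length ps) \<le> (\<Sum>g\<leftarrow>gs. c (snd (snd g))) \<and>
    (\<forall>z \<rho>. run ps z (\<rho>, 0) = (exec (\<lambda>l. val l z) gs \<rho>, 0))"
    using gs(1,2)
  proof (induction gs)
    case Nil
    then show ?case by (intro exI[of _ "[]"]) auto
  next
    case (Cons g gs)
    obtain a b l where g: "g = (a, b, l)" by (cases g)
    obtain ps where ps: "program A (?X \<times> {..<N}) ps" "real (length ps) \<le> (\<Sum>g\<leftarrow>gs. c (snd (snd g)))"
      "\<And>z \<rho>. run ps z (\<rho>, 0) = (exec (\<lambda>l. val l z) gs \<rho>, 0)"
      using Cons g by auto
    have ab: "a < R" "b < R" "a \<noteq> b" "l \<in> G" using Cons.prems g by auto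
    define h where "h = add_prod (\<lambda>_. True) a b ()"
    have "h (h \<rho>) = \<rho>" for \<rho> using ab(3) by (auto simp: h_def add_prod_def fun_eq_iff)
    moreover have "h ` ?X \<subseteq> ?X" using ab(2) by (auto simp: h_def add_prod_def)
    ultimately have "bij_betw h ?X ?X" by (intro bij_betw_byWitness[where f' = h]) auto
    from computes_apply[OF G[OF ab(4), THEN conjunct1] this]
    obtain qs where qs: "program A (?X \<times> {..<N}) qs" "length qs \<le> 2 * len l + 1"
      "\<And>z \<rho>. run qs z (\<rho>, 0) = ((if val l z then h \<rho> else \<rho>), 0)" by blast
    have "(if val l z then h \<rho> else \<rho>) = add_prod (\<lambda>l. val l z) a b l \<rho>" for z \<rho>
      by (simp add: h_def add_prod_def)
    then have "run (qs @ ps) z (\<rho>, 0) = (exec (\<lambda>l. val l z) (g # gs) \<rho>, 0)" for z \<rho>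
      by (simp add: qs(3) ps(3) g)
    moreover have "real (length qs) \<le> c l"
      unfolding G[OF ab(4), THEN conjunct2] using qs(2) by (rule of_nat_mono)
    ultimately show ?case using qs(1) ps(1,2) g by (intro exI[of _ "qs @ ps"]) auto
  qed
  then obtain ps where ps: "program A (?X \<times> {..<N}) ps" "real (length ps) \<le> x"
    "\<And>z \<rho>. run ps z (\<rho>, 0) = (add_prod (\<lambda>_. f z) 0 1 () \<rho>, 0)"
    using gs(3,4) by auto
  \<comment> \<open>Register 0 holds the constant 1 and register 1 the bit \<open>b\<close>, so
    adding register 0 times \<open>f\<close> to register 1 adds \<open>f\<close> itself.\<close>
  let ?e = "\<lambda>b. ((\<lambda>i. i = 0 \<or> i = 1 \<and> b), 0::nat)"
  show ?thesis
  proof (rule computesI[where e = ?e, OF _ _ _ _ _ ps(1)])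
    show "finite (?X \<times> {..<N})" using card_bounded_registers(1) by simp
    show "card (?X \<times> {..<N}) \<le> 2 ^ R * N"
      using card_bounded_registers(2)[of R] by (simp add: card_cartesian_product)
    show "length ps \<le> L" using ps(2) x by linarith
    show "run ps z (?e b) = ?e (b \<noteq> f z)" for z b
      unfolding ps(3) by (auto simp: add_prod_def fun_eq_iff)
  qed (use R N in \<open>auto simp: fun_eq_iff\<close>)
qed

section \<open>Counting true inputs modulo small numbers\<close>

definition count :: "('l \<Rightarrow> input \<Rightarrow> bool) \<Rightarrow> 'l list \<Rightarrow> input \<Rightarrow> nat" where
  "count val xs z = length (filter (\<lambda>l. val l z) xs)"

text \<open>The permutation is applied once for every true input; taken as a cycle of length
  \<open>q\<close>, it counts modulo \<open>q\<close>.\<close>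

lemma count_pass:
  assumes "\<And>l. l \<in> set xs \<Longrightarrow> computes A N (len l) (val l)" "bij_betw g X X"
  shows "\<exists>ps. program A (X \<times> {..<N}) ps \<and> length ps \<le> (\<Sum>l\<leftarrow>xs. 2 * len l + 1) \<and>
    (\<forall>z x. run ps z (x, 0) = ((g ^^ count val xs z) x, 0))"
  using assms(1)
proof (induction xs)
  case Nil
  then show ?case by (intro exI[of _ "[]"]) (auto simp: count_def)
next
  case (Cons l xs)
  then obtain ps where ps: "program A (X \<times> {..<N}) ps" "length ps \<le> (\<Sum>l\<leftarrow>xs. 2 * len l + 1)"
    "\<And>z x. run ps z (x, 0) = ((g ^^ count val xs z) x, 0)"
    by auto
  obtain qs where qs: "program A (X \<times> {..<N}) qs" "length qs \<le> 2 * len l + 1"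
    "\<And>z x. run qs z (x, 0) = ((if val l z then g x else x), 0)"
    using computes_apply[OF _ assms(2)] Cons.prems by (metis list.set_intros(1))
  show ?case
    using ps qs by (intro exI[of _ "qs @ ps"]) (auto simp: count_def funpow_swap1)
qed

lemma bij_betw_add_mod: "bij_betw (\<lambda>c. (c + k) mod q) {..<q} {..<q::nat}"
proof (cases "q = 0")
  case False
  let ?k = "q - k mod q"
  have "k + ?k = q * (k div q) + q"
    using False mult_div_mod_eq[of q k] mod_less_divisor[of q k] by linarith
  then have k: "(k + ?k) mod q = 0" by simp
  have "((c + k) mod q + ?k) mod q = c" "((c + ?k) mod q + k) mod q = c" if "c < q" for c
  proof -
    have "((c + k) mod q + ?k) mod q = (c + (k + ?k) mod q) mod q"
      "((c + ?k) mod q + k) mod q = (c + (k + ?k) mod q) mod q"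
      by (simp_all add: mod_simps algebra_simps)
    then show "((c + k) mod q + ?k) mod q = c" "((c + ?k) mod q + k) mod q = c"
      using that unfolding k by simp_all
  qed
  then show ?thesis
    using False by (intro bij_betw_byWitness[where f' = "\<lambda>c. (c + ?k) mod q"]) auto
qed (simp add: bij_betw_def)

text \<open>Count modulo \<open>q\<close>, add a function of the residue to an accumulator modulo
  \<open>D\<close>, and count back. The counter always has \<open>Q\<close> states, with those from
  \<open>q\<close> on left fixed, so that different moduli can share it.\<close>

lemma acc_add:
  fixes a :: "nat \<Rightarrow> nat" and D :: nat
  assumes xs: "\<And>l. l \<in> set xs \<Longrightarrow> computes A N (len l) (val l)" and N: "2 \<le> N"
    and q: "0 < q" "q \<le> Q"
  shows "\<exists>ps. program A (({..<D} \<times> {..<Q}) \<times> {..<N}) ps \<and>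
    length ps \<le> 2 * (\<Sum>l\<leftarrow>xs. 2 * len l + 1) + 1 \<and>
    (\<forall>z. \<forall>x<D. run ps z ((x, 0), 0) = (((x + a (count val xs z mod q)) mod D, 0), 0))"
proof -
  let ?X = "{..<D} \<times> {..<Q}"
  define s where "s c = (if c < q then (c + 1) mod q else c)" for c
  have "bij_betw s ({..<q} \<union> {q..<Q}) ({..<q} \<union> {q..<Q})"
  proof (rule bij_betw_combine)
    show "bij_betw s {..<q} {..<q}"
      using bij_betw_add_mod[of 1 q] by (subst bij_betw_cong[of _ _ "\<lambda>c. (c + 1) mod q"]) (auto simp: s_def)
    show "bij_betw s {q..<Q} {q..<Q}"
      by (subst bij_betw_cong[of _ _ id]) (auto simp: s_def)
  qed auto
  moreover have "{..<q} \<union> {q..<Q} = {..<Q}" using q by auto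
  ultimately have "bij_betw s {..<Q} {..<Q}" by simp
  then have "bij_betw (map_prod id s) ?X ?X" by (intro bij_betw_map_prod bij_betw_id)
  from count_pass[where len = len, OF xs this]
  obtain ps where ps: "program A (?X \<times> {..<N}) ps" "length ps \<le> (\<Sum>l\<leftarrow>xs. 2 * len l + 1)"
    "\<And>z x. run ps z (x, 0) = ((map_prod id s ^^ count val xs z) x, 0)" by blast
  have pow: "(map_prod id s ^^ n) (x, 0) = (x, n mod q)" for n x
    using q(1) by (induction n) (auto simp: s_def mod_Suc_eq mod_Suc)
  obtain qs where qs: "program A (?X \<times> {..<N}) qs" "length qs = length ps"
    "\<And>z s. s \<in> ?X \<times> {..<N} \<Longrightarrow> run qs z (run ps z s) = s"
    using program_inverse[OF ps(1)] by blast
  let ?add = "\<lambda>z::input. map_prod (\<lambda>(x, c). ((x + a c) mod D, c)) (id :: nat \<Rightarrow> nat)"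
  have "local_step A (?X \<times> {..<N}) ?add"
    by (intro local_step_const bij_betw_map_prod bij_betw_id bij_betw_controlled bij_betw_add_mod)
  then have "program A (?X \<times> {..<N}) (ps @ [?add] @ qs)" using ps(1) qs(1) by simp
  moreover have "run (ps @ [?add] @ qs) z ((x, 0), 0) = (((x + a (count val xs z mod q)) mod D, 0), 0)"
    if "x < D" for z x
  proof -
    let ?y = "(x + a (count val xs z mod q)) mod D"
    \<comment> \<open>Counting ignores the accumulator, so its inverse clears the counter even
      though the accumulator has changed in between.\<close>
    have "run ps z ((?y, 0), 0) = ((?y, count val xs z mod q), 0)" by (simp add: ps(3) pow)
    moreover have "((?y, 0), 0) \<in> ?X \<times> {..<N}" using that q N by auto
    ultimately have "run qs z ((?y, count val xs z mod q), 0) = ((?y, 0), 0)" using qs(3) by metis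
    then show ?thesis by (simp add: ps(3) pow)
  qed
  ultimately show ?thesis using ps(2) qs(2) by (intro exI[of _ "ps @ [?add] @ qs"]) auto
qed

text \<open>The moduli are treated one after the other with the same counter, so their number
  \<open>j\<close> enters the length but not the width.\<close>

lemma computes_acc:
  assumes xs: "\<And>l. l \<in> set xs \<Longrightarrow> computes A N (len l) (val l)" and N: "2 \<le> N" and D: "0 < D"
    and q: "\<And>i. i < j \<Longrightarrow> 0 < q i \<and> q i \<le> Q" and Q: "0 < Q"
  shows "computes A (2 * (D * Q * N)) (2 * (j * (2 * (\<Sum>l\<leftarrow>xs. 2 * len l + 1) + 1)) + 1)
    (\<lambda>z. \<phi> ((\<Sum>i<j. a i (count val xs z mod q i)) mod D))"
proof -
  let ?X = "{..<D} \<times> {..<Q}" and ?S = "\<Sum>l\<leftarrow>xs. 2 * len l + 1"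
  have "\<exists>ps. program A (?X \<times> {..<N}) ps \<and> length ps \<le> j * (2 * ?S + 1) \<and>
    (\<forall>z. run ps z ((0, 0), 0) = (((\<Sum>i<j. a i (count val xs z mod q i)) mod D, 0), 0))"
    using q
  proof (induction j)
    case 0
    then show ?case using D by (intro exI[of _ "[]"]) auto
  next
    case (Suc j)
    then obtain ps where ps: "program A (?X \<times> {..<N}) ps" "length ps \<le> j * (2 * ?S + 1)"
      "\<And>z. run ps z ((0, 0), 0) = (((\<Sum>i<j. a i (count val xs z mod q i)) mod D, 0), 0)"
      by auto
    have "0 < q j" "q j \<le> Q" using Suc.prems[of j] by auto
    from acc_add[where D = D and a = "a j" and val = val and len = len, OF xs N this]
    obtain qs where qs: "program A (?X \<times> {..<N}) qs" "length qs \<le> 2 * ?S + 1"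
      "\<And>z x. x < D \<Longrightarrow> run qs z ((x, 0), 0) = (((x + a j (count val xs z mod q j)) mod D, 0), 0)"
      by blast
    show ?case using ps qs D by (intro exI[of _ "ps @ qs"]) (auto simp: mod_simps)
  qed
  then obtain ps where ps: "program A (?X \<times> {..<N}) ps" "length ps \<le> j * (2 * ?S + 1)"
    "\<And>z. run ps z ((0, 0), 0) = (((\<Sum>i<j. a i (count val xs z mod q i)) mod D, 0), 0)" by blast
  show ?thesis
  proof (rule computes_forward[where S = "?X \<times> {..<N}" and a = "((0, 0), 0)" and ps = ps
        and \<phi> = "\<lambda>((x, c), n). \<phi> x"])
  qed (use ps N D Q in \<open>auto simp: card_cartesian_product\<close>)
qed

section \<open>Majority gates\<close>

text \<open>One modulus is split off at a time by dividing the Bezout identity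
  \<open>x * M + y * q j = 1\<close> by \<open>M * q j\<close>. The entry \<open>k j\<close>, past
  the last modulus, takes up the integer part.\<close>

lemma partial_fractions:
  fixes q :: "nat \<Rightarrow> int"
  assumes "\<And>i i'. i < i' \<Longrightarrow> i' < j \<Longrightarrow> coprime (q i) (q i')" "\<And>i. i < j \<Longrightarrow> 0 < q i"
  shows "\<exists>k::nat \<Rightarrow> int. 1 / real_of_int (\<Prod>i<j. q i) = (\<Sum>i<j. real_of_int (k i) / real_of_int (q i)) + real_of_int (k j)"
  using assms
proof (induction j)
  case 0
  then show ?case by (intro exI[of _ "\<lambda>_. 1"]) simp
next
  case (Suc j)
  let ?M = "\<Prod>i<j. q i"
  obtain k where k: "1 / real_of_int ?M = (\<Sum>i<j. real_of_int (k i) / real_of_int (q i)) + real_of_int (k j)"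
    using Suc.IH Suc.prems by force
  have "coprime ?M (q j)" using Suc.prems(1) by (intro prod_coprime_left) auto
  then obtain x y where xy: "x * ?M + y * q j = 1"
    using bezout_int[of ?M "q j"] by (auto simp: coprime_iff_gcd_eq_1)
  have M: "0 < ?M" using Suc.prems(2) by (intro prod_pos) auto
  have qj: "0 < q j" using Suc.prems(2) by simp
  define k' where "k' i = (if i < j then y * k i else if i = j then x else y * k j)" for i
  have "real_of_int x * real_of_int ?M + real_of_int y * real_of_int (q j) = 1"
    using xy by (metis of_int_1 of_int_add of_int_mult)
  then have "1 / (real_of_int ?M * real_of_int (q j)) =
      real_of_int x / real_of_int (q j) + real_of_int y * (1 / real_of_int ?M)"
  proof -
    have "1 / (a * b) = x' / b + y' * (1 / a)" if "x' * a + y' * b = 1" "a \<noteq> 0" "b \<noteq> 0" for a b x' y' :: real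
    proof -
      have "x' / b + y' * (1 / a) = (x' * a + y' * b) / (a * b)" using that(2,3) by (simp add: field_simps)
      then show ?thesis using that(1) by simp
    qed
    moreover have "real_of_int ?M \<noteq> 0" "real_of_int (q j) \<noteq> 0"
      using M qj by (metis less_irrefl of_int_eq_0_iff)+
    ultimately show ?thesis using \<open>real_of_int x * real_of_int ?M + _ = 1\<close> by blast
  qed
  also have "\<dots> = (\<Sum>i<Suc j. real_of_int (k' i) / real_of_int (q i)) + real_of_int (k' (Suc j))"
    unfolding k by (simp add: k'_def algebra_simps sum_distrib_left)
  finally show ?case by (intro exI[of _ k']) (simp add: mult.commute)
qed

text \<open>Multiplying \<open>y\<close> by a partial fraction decomposition of \<open>1 / M\<close> and rounding each
  summand down yields \<open>D * y / M\<close> modulo \<open>D\<close> up to an error of \<open>j\<close>.\<close>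

lemma residue_sum_approx:
  fixes q k :: "nat \<Rightarrow> int" and D y :: int
  assumes q: "\<And>i. i < j \<Longrightarrow> 0 < q i"
    and k: "1 / real_of_int M = (\<Sum>i<j. real_of_int (k i) / real_of_int (q i)) + real_of_int k0"
  defines "b \<equiv> (\<Sum>i<j. (D * (y * k i mod q i)) div q i) mod D"
  assumes D: "4 * int j \<le> D" "0 < D" and y: "4 * \<bar>y\<bar> < M" and M: "0 < M"
  shows "2 * b < D \<Longrightarrow> 0 \<le> y"
    and "D \<le> 2 * b \<Longrightarrow> b + int j < D \<Longrightarrow> y < 0"
    and "D \<le> b + int j \<Longrightarrow> \<bar>y\<bar> * D \<le> int j * M"
proof -
  define e where "e i = (D * (y * k i mod q i)) / real_of_int (q i)" for i
  define S where "S = (\<Sum>i<j. (D * (y * k i mod q i)) div q i)"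
  \<comment> \<open>Each of the \<open>j\<close> floors loses between 0 and 1.\<close>
  define err where "err = (\<Sum>i<j. e i) - real_of_int S"
  have "0 \<le> e i - real_of_int ((D * (y * k i mod q i)) div q i) \<and>
      e i - real_of_int ((D * (y * k i mod q i)) div q i) \<le> 1" for i
    unfolding e_def floor_divide_of_int_eq[symmetric, where 'a = real] by linarith
  then have "0 \<le> (\<Sum>i<j. e i - real_of_int ((D * (y * k i mod q i)) div q i))"
    "(\<Sum>i<j. e i - real_of_int ((D * (y * k i mod q i)) div q i)) \<le> (\<Sum>i<j. 1)"
    by (intro sum_nonneg sum_mono; blast)+
  then have err: "0 \<le> err" "err \<le> real j"
    unfolding err_def S_def by (simp_all add: sum_subtractf)
  \<comment> \<open>The exact value to be approximated; the bound on \<open>y\<close> keeps it below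
    \<open>D / 4\<close> in absolute value.\<close>
  define \<beta> where "\<beta> = real_of_int D * real_of_int y / real_of_int M"
  define Z where "Z = (\<Sum>i<j. (y * k i) div q i) + y * k0"
  have "e i = real_of_int D * real_of_int y * (real_of_int (k i) / real_of_int (q i)) - real_of_int D * real_of_int ((y * k i) div q i)"
    if "i < j" for i
  proof -
    have "real_of_int (y * k i mod q i) =
        real_of_int y * real_of_int (k i) - real_of_int (q i) * real_of_int ((y * k i) div q i)"
      by (metis minus_mult_div_eq_mod of_int_diff of_int_mult)
    then have "e i = real_of_int D *
        (real_of_int y * real_of_int (k i) - real_of_int (q i) * real_of_int ((y * k i) div q i)) / real_of_int (q i)"
      unfolding e_def by simp
    then show ?thesis using q[OF that] by (simp add: field_simps)
  qed
  then have "(\<Sum>i<j. e i) = (\<Sum>i<j. real_of_int D * real_of_int y * (real_of_int (k i) / real_of_int (q i)) - real_of_int D * real_of_int ((y * k i) div q i))"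
    by (intro sum.cong) auto
  also have "\<dots> = real_of_int D * real_of_int y * (\<Sum>i<j. real_of_int (k i) / real_of_int (q i)) - real_of_int D * real_of_int (\<Sum>i<j. (y * k i) div q i)"
    by (simp add: sum_subtractf sum_distrib_left)
  also have "\<dots> = \<beta> - real_of_int D * real_of_int Z"
  proof -
    have "(\<Sum>i<j. real_of_int (k i) / real_of_int (q i)) = 1 / real_of_int M - real_of_int k0" using k by simp
    show ?thesis unfolding \<open>_ = 1 / real_of_int M - real_of_int k0\<close> \<beta>_def Z_def by (simp add: algebra_simps)
  qed
  finally have sum: "(\<Sum>i<j. e i) = \<beta> - real_of_int D * real_of_int Z" .
  define n where "n = Z + S div D"
  have "b = S - D * (S div D)" unfolding b_def S_def by (simp add: minus_mult_div_eq_mod)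
  then have "real_of_int b = real_of_int S - real_of_int D * real_of_int (S div D)" by simp
  then have b: "real_of_int b = \<beta> - err - real_of_int (D * n)"
    using sum unfolding err_def n_def by (simp add: algebra_simps)
  have b_range: "0 \<le> b" "b < D" using D by (simp_all add: b_def)
  have D4: "4 * real j \<le> real_of_int D" using D(1) by linarith
  have "4 * \<bar>real_of_int y\<bar> < real_of_int M" using y by linarith
  then have "4 * \<bar>\<beta>\<bar> < real_of_int D"
    using D M unfolding \<beta>_def by (simp add: abs_mult field_simps)
  then have \<beta>: "4 * \<beta> < real_of_int D" "- real_of_int D < 4 * \<beta>" by linarith+
  have y_iff: "0 \<le> y \<longleftrightarrow> 0 \<le> \<beta>" using D M unfolding \<beta>_def by (simp add: zero_le_mult_iff zero_le_divide_iff)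
  \<comment> \<open>\<open>\<beta> - err\<close> lies strictly between \<open>- D\<close> and
    \<open>D\<close>, so reduction modulo \<open>D\<close> leaves it alone or adds \<open>D\<close>
    once. If \<open>D\<close> is added although \<open>\<beta>\<close> is nonnegative, only rounding
    made the difference negative, and then \<open>b\<close> is within \<open>j\<close> of
    \<open>D\<close>: the undecided case.\<close>
  have n: "n = 0 \<or> n = -1"
  proof (rule ccontr)
    assume "\<not> (n = 0 \<or> n = -1)"
    then have "1 \<le> n \<or> n \<le> -2" by linarith
    then have "D \<le> D * n \<or> D * n \<le> - (2 * D)"
      using D(2) mult_left_mono[of 1 n D] mult_left_mono[of n "-2" D] by linarith
    then have "real_of_int D \<le> real_of_int (D * n) \<or> real_of_int (D * n) \<le> real_of_int (- (2 * D))"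
      by (simp only: of_int_le_iff)
    then have "real_of_int D \<le> real_of_int (D * n) \<or> real_of_int (D * n) \<le> - 2 * real_of_int D"
      by simp
    then show False using b b_range err \<beta> D4 by linarith
  qed
  have n0: "2 * b < D" "0 \<le> y" "b + int j < D" if "n = 0"
  proof -
    have bb: "real_of_int b = \<beta> - err" using b that by simp
    show "2 * b < D" "b + int j < D" using bb err \<beta> D4 D(2) b_range by linarith+
    show "0 \<le> y" unfolding y_iff using bb err b_range by linarith
  qed
  have n1: "D \<le> 2 * b" "b + int j < D \<Longrightarrow> y < 0" "D \<le> b + int j \<Longrightarrow> \<bar>\<beta>\<bar> \<le> real j" if "n = -1"
  proof -
    have bb: "real_of_int b = \<beta> - err + real_of_int D" using b that by simp
    show "D \<le> 2 * b" using bb err \<beta> D4 by linarith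
    show "y < 0" if "b + int j < D"
    proof -
      have "\<beta> < 0" using bb err that by linarith
      then show ?thesis using y_iff by linarith
    qed
    show "\<bar>\<beta>\<bar> \<le> real j" if "D \<le> b + int j" using bb err that b_range by linarith
  qed
  show "0 \<le> y" if "2 * b < D" using n n0 n1(1) that by linarith
  show "y < 0" if "D \<le> 2 * b" "b + int j < D" using n n0(1) n1(2) that by linarith
  show "\<bar>y\<bar> * D \<le> int j * M" if "D \<le> b + int j"
  proof -
    have "\<bar>\<beta>\<bar> \<le> real j" using n n0(3) n1(3) that by linarith
    then have "\<bar>real_of_int y\<bar> * real_of_int D \<le> real j * real_of_int M"
      using D(2) M unfolding \<beta>_def by (simp add: abs_mult field_simps)
    then have "real_of_int (\<bar>y\<bar> * D) \<le> real_of_int (int j * M)" by simp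
    then show ?thesis by linarith
  qed
qed

text \<open>The moduli of Goedel's beta function: a common divisor divides \<open>i' - i\<close>,
  hence \<open>fact r\<close>, hence each modulus minus 1, and therefore 1.\<close>

lemma coprime_moduli:
  fixes a :: int
  assumes "i < i'" "i' < r"
  shows "coprime (1 + int (i + 1) * (a * fact r)) (1 + int (i' + 1) * (a * fact r))"
proof (rule coprimeI)
  fix d assume d: "d dvd 1 + int (i + 1) * (a * fact r)" "d dvd 1 + int (i' + 1) * (a * fact r)"
  let ?X = "a * fact r"
  have "d dvd int (i' + 1) * (1 + int (i + 1) * ?X) - int (i + 1) * (1 + int (i' + 1) * ?X)"
    using d by (intro dvd_diff dvd_mult)
  also have "\<dots> = int (i' - i)" using assms by (simp add: algebra_simps of_nat_diff)
  finally have "d dvd int (i' - i)" .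
  moreover have "int (i' - i) dvd int (fact r)"
    using assms by (intro of_nat_dvd_iff[THEN iffD2] dvd_fact) auto
  ultimately have "d dvd fact r" by (metis dvd_trans of_nat_fact)
  then have "d dvd int (i + 1) * ?X" by simp
  with d(1) show "is_unit d" by (metis dvd_add_left_iff)
qed

text \<open>Shows that the counter modulo \<open>q\<close> already determines the residue that
  enters the approximation.\<close>

lemma nat_mod_shift:
  fixes k m :: int
  shows "(2 * int (c mod q) - m) * k mod int q = (2 * int c - m) * k mod int q"
proof -
  have "(2 * int (c mod q) - m) * k mod int q = (2 * (int c mod int q) - m) * k mod int q"
    by (simp add: zmod_int)
  also have "\<dots> = (2 * int c - m) * k mod int q"
    by (intro mod_mult_cong mod_diff_cong refl mod_mod_trivial)
  finally show ?thesis .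
qed

text \<open>Induction on the number of moduli. The approximation from \<open>j + 1\<close> moduli
  either settles the sign or shows that \<open>y\<close> is small enough for the first
  \<open>j\<close> of them. The value of \<open>P\<close> is arbitrary on inputs that violate the
  size bound.\<close>

lemma computes_sign:
  assumes xs: "\<And>l. l \<in> set xs \<Longrightarrow> computes A N (len l) (val l)" and N: "2 \<le> N"
    and q: "\<And>i. i < r \<Longrightarrow> 0 < q i \<and> q i \<le> Q" and Q: "0 < Q"
    and cop: "\<And>i i'. i < i' \<Longrightarrow> i' < r \<Longrightarrow> coprime (int (q i)) (int (q i'))"
    and D: "4 * r * Q < D" and H: "2 * (r * (2 * (\<Sum>l\<leftarrow>xs. 2 * len l + 1) + 1)) + 1 \<le> H"
  defines "y \<equiv> \<lambda>z. 2 * int (count val xs z) - int (length xs)"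
  shows "j \<le> r \<Longrightarrow> \<exists>P. computes A (64 ^ j * (2 * (D * Q * N))) (61 ^ j * H) P \<and>
    (\<forall>z. 4 * \<bar>y z\<bar> < (\<Prod>i<j. int (q i)) \<longrightarrow> P z = (0 \<le> y z))"
proof (induction j)
  case 0
  have "1 \<le> D * Q" using D Q by (simp add: Suc_le_eq)
  then have "2 \<le> 2 * (D * Q * N)" using N by simp
  then have "computes A (2 * (D * Q * N)) 1 (\<lambda>_. True)" by (rule computes_const)
  moreover have "1 \<le> H" using H by simp
  ultimately have "computes A (2 * (D * Q * N)) H (\<lambda>_. True)" using computes_mono by blast
  \<comment> \<open>The empty product is 1, so the size bound forces \<open>y\<close> to be
    0.\<close>
  then show ?case by (intro exI[of _ "\<lambda>_. True"]) auto
next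
  case (Suc j)
  let ?W = "2 * (D * Q * N)" and ?M = "\<Prod>i<Suc j. int (q i)"
  have "j < r" using Suc.prems by simp
  obtain P where P: "computes A (64 ^ j * ?W) (61 ^ j * H) P"
    "\<And>z. 4 * \<bar>y z\<bar> < (\<Prod>i<j. int (q i)) \<Longrightarrow> P z = (0 \<le> y z)"
    using Suc by auto
  have "\<exists>k. 1 / real_of_int ?M = (\<Sum>i<Suc j. real_of_int (k i) / real_of_int (int (q i))) + real_of_int (k (Suc j))"
    using cop q Suc.prems by (intro partial_fractions) auto
  then obtain k where k: "1 / real_of_int ?M = (\<Sum>i<Suc j. real_of_int (k i) / real_of_int (int (q i))) + real_of_int (k (Suc j))"
    by blast
  define b where "b z = (\<Sum>i<Suc j. (int D * (y z * k i mod int (q i))) div int (q i)) mod int D" for z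
  define a where "a i c = nat ((int D * ((2 * int c - int (length xs)) * k i mod int (q i))) div int (q i))" for i c
  have D0: "0 < D" using D by simp
  have "int (a i (count val xs z mod q i)) = (int D * (y z * k i mod int (q i))) div int (q i)"
    if "i < Suc j" for i z
  proof -
    have "0 < int (q i)" using q[of i] that Suc.prems by simp
    then have "0 \<le> (int D * (y z * k i mod int (q i))) div int (q i)"
      by (intro pos_imp_zdiv_nonneg_iff[THEN iffD2]) auto
    then show ?thesis unfolding a_def nat_mod_shift y_def by simp
  qed
  then have b: "b z = int ((\<Sum>i<Suc j. a i (count val xs z mod q i)) mod D)" for z
    unfolding b_def of_nat_mod of_nat_sum by (intro arg_cong2[where f = "(mod)"] sum.cong) auto
  have acc: "computes A ?W H (\<lambda>z. \<phi> (b z))" for \<phi> :: "int \<Rightarrow> bool"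
  proof -
    have "computes A ?W (2 * (Suc j * (2 * (\<Sum>l\<leftarrow>xs. 2 * len l + 1) + 1)) + 1)
      (\<lambda>z. (\<phi> \<circ> int) ((\<Sum>i<Suc j. a i (count val xs z mod q i)) mod D))"
      using q Suc.prems D0 Q by (intro computes_acc xs N) auto
    moreover have "Suc j * (2 * (\<Sum>l\<leftarrow>xs. 2 * len l + 1) + 1) \<le> r * (2 * (\<Sum>l\<leftarrow>xs. 2 * len l + 1) + 1)"
      using Suc.prems by (intro mult_le_mono1)
    then have "2 * (Suc j * (2 * (\<Sum>l\<leftarrow>xs. 2 * len l + 1) + 1)) + 1 \<le> H" using H by linarith
    ultimately show ?thesis unfolding b using computes_mono[OF _ order_refl] by simp
  qed
  have W: "?W \<le> 64 ^ j * ?W" "8 * ?W \<le> 8 * (64 ^ j * ?W)" by simp_all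
  have H1: "H \<le> 61 ^ j * H" by simp
  \<comment> \<open>A value of \<open>b\<close> in the lower half means that \<open>y\<close> is
    nonnegative, one close to \<open>D\<close> leaves the sign open, and any other means that
    \<open>y\<close> is negative.\<close>
  define hi where "hi z \<longleftrightarrow> 2 * b z < int D" for z
  define near where "near z \<longleftrightarrow> int D \<le> b z + int (Suc j)" for z
  have nearP: "computes A (8 * (64 ^ j * ?W)) (4 * H + 4 * (61 ^ j * H) + 5) (\<lambda>z. near z \<and> P z)"
    unfolding near_def by (intro computes_op computes_mono[OF acc W(1) order_refl] P(1))
  have hi: "computes A (8 * (64 ^ j * ?W)) H hi"
  proof -
    have "?W \<le> 8 * (64 ^ j * ?W)" using W by linarith
    then show ?thesis
      unfolding hi_def using computes_mono[OF acc[of "\<lambda>v. 2 * v < int D"] _ order_refl] by blast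
  qed
  have hi_or: "computes A (8 * (8 * (64 ^ j * ?W))) (4 * H + 4 * (4 * H + 4 * (61 ^ j * H) + 5) + 5)
      (\<lambda>z. hi z \<or> (near z \<and> P z))"
    by (rule computes_op[where op = "(\<or>)", OF hi nearP])
  \<comment> \<open>Two binary operations multiply the width by 8 each. With \<open>T\<close> for
    \<open>61 ^ j * H\<close>, their length is \<open>20 * H + 16 * T + 25\<close>, at most
    \<open>61 * T\<close> since \<open>1 \<le> H\<close> and \<open>H \<le> T\<close>.\<close>
  have W': "8 * (8 * (64 ^ j * ?W)) \<le> 64 ^ Suc j * ?W" by simp
  have H': "4 * H + 4 * (4 * H + 4 * (61 ^ j * H) + 5) + 5 \<le> 61 ^ Suc j * H"
  proof -
    have le: "4 * H + 4 * (4 * H + 4 * T + 5) + 5 \<le> 61 * T" if "H \<le> T" "1 \<le> H" for T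
    proof -
      have "20 * H + 16 * T + 25 \<le> 20 * T + 16 * T + 25 * T"
        using that by (intro add_mono mult_le_mono2) auto
      then show ?thesis by simp
    qed
    have "1 \<le> H" using H by simp
    from le[OF H1 this] show ?thesis by (simp only: power_Suc mult.assoc)
  qed
  have "computes A (64 ^ Suc j * ?W) (61 ^ Suc j * H) (\<lambda>z. hi z \<or> (near z \<and> P z))"
    by (rule computes_mono[OF hi_or W' H'])
  moreover have "(hi z \<or> (near z \<and> P z)) = (0 \<le> y z)" if y: "4 * \<bar>y z\<bar> < ?M" for z
  proof -
    have qi: "0 < int (q i)" if "i < Suc j" for i using q[of i] that Suc.prems by simp
    have M: "0 < ?M" using qi by (intro prod_pos) auto
    have "Suc j * q j \<le> r * Q" using q[of j] Suc.prems by (intro mult_le_mono) auto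
    then have DQ: "4 * (Suc j * q j) < D" using D by simp
    have "Suc j * 1 \<le> Suc j * q j" using q[of j] Suc.prems by (intro mult_le_mono2) auto
    then have D4: "4 * int (Suc j) \<le> int D" using DQ by linarith
    note approx = residue_sum_approx[where j = "Suc j" and q = "\<lambda>i. int (q i)" and k = k and D = "int D" and y = "y z" and M = ?M,
        OF qi k D4 _ y M, folded b_def]
    have D0': "0 < int D" using D0 by simp
    show ?thesis
    proof (cases "hi z")
      case True
      then show ?thesis using approx(1)[OF _ D0'] unfolding hi_def by blast
    next
      case hi: False
      show ?thesis
      proof (cases "near z")
        case True
        then have "\<bar>y z\<bar> * int D \<le> int (Suc j) * ?M" using approx(3)[OF _ D0'] unfolding near_def by blast
        moreover have "?M = (\<Prod>i<j. int (q i)) * int (q j)" by simp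
        ultimately have "\<bar>y z\<bar> * int D \<le> int (Suc j * q j) * (\<Prod>i<j. int (q i))" by (simp add: algebra_simps)
        moreover have M': "0 < (\<Prod>i<j. int (q i))" using qi by (intro prod_pos) auto
        have "int (4 * (Suc j * q j)) * (\<Prod>i<j. int (q i)) < int D * (\<Prod>i<j. int (q i))"
          using DQ M' by (intro mult_strict_right_mono) linarith+
        ultimately have "int D * (4 * \<bar>y z\<bar>) < int D * (\<Prod>i<j. int (q i))" by (simp add: algebra_simps)
        then have "4 * \<bar>y z\<bar> < (\<Prod>i<j. int (q i))" using D0' by simp
        then show ?thesis using P(2) hi True by blast
      next
        case False
        then show ?thesis using approx(2)[OF _ D0'] hi unfolding near_def hi_def by force
      qed
    qed
  qed
  ultimately show ?case by blast
qed

text \<open>With \<open>r\<close> moduli of size about \<open>m powr (1 / r)\<close>, where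
  \<open>m\<close> is the fan-in, counter and accumulator together take about
  \<open>m powr (2 / r)\<close> states, while the number of passes over the inputs depends on
  \<open>r\<close> only.\<close>

lemma computes_majority:
  assumes r: "1 \<le> r"
  shows "\<exists>C::real. 0 \<le> C \<and> (\<forall>A N (xs :: 'l list) val len. xs \<noteq> [] \<longrightarrow> 2 \<le> N \<longrightarrow>
    (\<forall>l\<in>set xs. computes A N (len l) (val l)) \<longrightarrow>
    (\<exists>N' L'. computes A N' L' (\<lambda>z. length xs \<le> 2 * count val xs z) \<and>
      real N' \<le> C * real (length xs) powr (2 / real r) * real N \<and>
      real L' \<le> C * (\<Sum>l\<leftarrow>xs. real (len l) + 1)))"
proof -
  \<comment> \<open>\<open>c1\<close> bounds \<open>Q\<close> in units of
    \<open>m powr (1 / r)\<close>. The width contains \<open>2 * D * Q\<close>, and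
    \<open>D \<le> 5 * r * Q\<close>, which gives the factor 10 and the square of \<open>c1\<close>
    in \<open>C1\<close>.\<close>
  define c1 where "c1 = 20 * real r * fact r"
  define C1 where "C1 = 64 ^ r * (10 * real r * c1\<^sup>2)"
  define C2 where "C2 = 61 ^ r * (10 * real r + 1)"
  have c1: "0 \<le> c1" by (simp add: c1_def)
  have C: "0 \<le> C1" "0 \<le> C2" by (simp_all add: C1_def C2_def)
  show ?thesis
  proof (intro exI[of _ "C1 + C2"] conjI allI impI)
    show "0 \<le> C1 + C2" using C by simp
    fix A N val len and xs :: "'l list"
    assume ne: "xs \<noteq> []" and N: "2 \<le> N" and xs: "\<forall>l\<in>set xs. computes A N (len l) (val l)"
    define m where "m = length xs"
    have m: "1 \<le> m" using ne by (simp add: m_def Suc_le_eq)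
    \<comment> \<open>Every modulus is at least \<open>B\<close>, so their product is at least
      \<open>5 * m\<close>; with 5 instead of 4 the required inequality with
      \<open>4 * \<bar>y\<bar>\<close> is strict.\<close>
    define B where "B = nat \<lceil>(5 * real m) powr (1 / real r)\<rceil>"
    have B: "(5 * real m) powr (1 / real r) \<le> real B" "real B \<le> (5 * real m) powr (1 / real r) + 1"
    proof -
      have "0 \<le> \<lceil>(5 * real m) powr (1 / real r)\<rceil>"
        using powr_ge_zero[of "5 * real m" "1 / real r"] by linarith
      then have "real B = of_int \<lceil>(5 * real m) powr (1 / real r)\<rceil>" by (simp add: B_def)
      then show "(5 * real m) powr (1 / real r) \<le> real B" "real B \<le> (5 * real m) powr (1 / real r) + 1"
        by linarith+
    qed
    have "real r * (1 / real r) = 1" using r by simp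
    then have "5 * real m = ((5 * real m) powr (1 / real r)) ^ r"
      using m r by (simp add: powr_powr powr_realpow[symmetric])
    also have "\<dots> \<le> real B ^ r" using B(1) by (intro power_mono) auto
    finally have "5 * real m \<le> real (B ^ r)" by simp
    then have Br: "5 * m \<le> B ^ r" by linarith
    have B1: "1 \<le> B" using Br m r by (cases "B = 0") (auto simp: power_0_left)
    define q where "q i = 1 + (i + 1) * (B * fact r)" for i
    define Q where "Q = 2 * r * fact r * B"
    have q: "0 < q i \<and> q i \<le> Q" if "i < r" for i
    proof -
      have "(i + 1) * (B * fact r) \<le> r * (B * fact r)" using that by (intro mult_le_mono1) auto
      moreover have "1 \<le> r * (B * fact r)" using r B1 by (simp add: Suc_le_eq)
      moreover have "Q = 2 * (r * (B * fact r))" by (simp add: Q_def)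
      ultimately show ?thesis unfolding q_def by linarith
    qed
    have Q: "0 < Q" using q[of 0] r by auto
    define D where "D = 4 * r * Q + 1"
    define H where "H = 2 * (r * (2 * (\<Sum>l\<leftarrow>xs. 2 * len l + 1) + 1)) + 1"
    have cop: "coprime (int (q i)) (int (q i'))" if "i < i'" "i' < r" for i i'
    proof -
      have "int (q i) = 1 + int (i + 1) * (int B * fact r)" for i by (simp add: q_def algebra_simps)
      then show ?thesis using coprime_moduli[OF that, of "int B"] by simp
    qed
    obtain P where P: "computes A (64 ^ r * (2 * (D * Q * N))) (61 ^ r * H) P"
      "\<And>z. 4 * \<bar>2 * int (count val xs z) - int m\<bar> < (\<Prod>i<r. int (q i)) \<Longrightarrow>
        P z = (0 \<le> 2 * int (count val xs z) - int m)"
      using computes_sign[where xs = xs and val = val and len = len and N = N and A = A and q = q and Q = Q and r = r and D = D and H = H and j = r]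
        xs N q Q cop unfolding D_def H_def m_def by auto
    have "P = (\<lambda>z. m \<le> 2 * count val xs z)"
    proof
      fix z
      have "count val xs z \<le> m" unfolding count_def m_def by (rule length_filter_le)
      then have "\<bar>2 * int (count val xs z) - int m\<bar> \<le> int m" by simp
      then have "4 * \<bar>2 * int (count val xs z) - int m\<bar> < int (5 * m)" using m by simp
      also have "\<dots> \<le> int (B ^ r)" using Br by linarith
      also have "\<dots> = (\<Prod>i<r. int B)" by simp
      also have "\<dots> \<le> (\<Prod>i<r. int (q i))"
      proof (rule prod_mono)
        fix i assume "i \<in> {..<r}"
        have "B * 1 \<le> (i + 1) * (B * fact r)"
          using mult_le_mono[of 1 "i + 1" B "B * fact r"] by (simp add: fact_ge_1)
        then have "B \<le> q i" unfolding q_def by linarith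
        then show "0 \<le> int B \<and> int B \<le> int (q i)" by simp
      qed
      finally show "P z = (m \<le> 2 * count val xs z)" using P(2)[of z] by linarith
    qed
    then have comp: "computes A (64 ^ r * (2 * (D * Q * N))) (61 ^ r * H) (\<lambda>z. length xs \<le> 2 * count val xs z)"
      using P(1) by (simp add: m_def)
    have "(5 * real m) powr (1 / real r) \<le> 5 * real m powr (1 / real r)"
    proof -
      have "(5::real) powr (1 / real r) \<le> 5 powr 1" using r by (intro powr_mono) auto
      then show ?thesis by (simp add: powr_mult mult_right_mono)
    qed
    moreover have mr: "1 \<le> real m powr (1 / real r)" using m by (simp add: ge_one_powr_ge_zero)
    ultimately have "real B \<le> 10 * real m powr (1 / real r)" using B(2) by linarith
    then have "2 * real r * fact r * real B \<le> 2 * real r * fact r * (10 * real m powr (1 / real r))"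
      by (intro mult_left_mono) auto
    then have QB: "real Q \<le> c1 * real m powr (1 / real r)" by (simp add: Q_def c1_def)
    have "1 \<le> r * Q" using r Q by (simp add: Suc_le_eq)
    then have "D \<le> 5 * r * Q" unfolding D_def by linarith
    then have "real D \<le> 5 * real r * real Q" by (metis of_nat_le_iff of_nat_mult of_nat_numeral)
    then have "real D * real Q \<le> 5 * real r * real Q * real Q" by (intro mult_right_mono) auto
    also have "\<dots> = 5 * real r * (real Q)\<^sup>2" by (simp add: power2_eq_square)
    also have "\<dots> \<le> 5 * real r * (c1 * real m powr (1 / real r))\<^sup>2"
      using QB by (intro mult_left_mono power_mono) auto
    also have "\<dots> = 5 * real r * c1\<^sup>2 * real m powr (2 / real r)"
      by (simp add: power_mult_distrib power2_eq_square powr_add[symmetric])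
    finally have "64 ^ r * (2 * ((real D * real Q) * real N)) \<le>
        64 ^ r * (2 * ((5 * real r * c1\<^sup>2 * real m powr (2 / real r)) * real N))"
      by (intro mult_left_mono mult_right_mono) auto
    then have "real (64 ^ r * (2 * (D * Q * N))) \<le> C1 * real m powr (2 / real r) * real N"
      by (simp add: C1_def algebra_simps)
    also have "\<dots> \<le> (C1 + C2) * real m powr (2 / real r) * real N"
      using C by (intro mult_right_mono) auto
    finally have NN: "real (64 ^ r * (2 * (D * Q * N))) \<le> (C1 + C2) * real (length xs) powr (2 / real r) * real N"
      by (simp add: m_def)
    define S where "S = (\<Sum>l\<leftarrow>xs. real (len l) + 1)"
    have S1: "1 \<le> S"
    proof -
      have "(\<Sum>l\<leftarrow>xs. (1::real)) \<le> S" unfolding S_def by (rule sum_list_mono) simp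
      then show ?thesis using m by (simp add: sum_list_triv m_def)
    qed
    have "real (\<Sum>l\<leftarrow>xs. 2 * len l + 1) \<le> 2 * S"
      unfolding S_def by (induction xs) auto
    then have "real r * (2 * real (\<Sum>l\<leftarrow>xs. 2 * len l + 1) + 1) \<le> real r * (5 * S)"
      using S1 by (intro mult_left_mono) auto
    then have "real H \<le> (10 * real r + 1) * S" using S1 unfolding H_def by (simp add: algebra_simps)
    then have "61 ^ r * real H \<le> 61 ^ r * ((10 * real r + 1) * S)" by (intro mult_left_mono) auto
    then have "real (61 ^ r * H) \<le> C2 * S" by (simp add: C2_def algebra_simps)
    also have "\<dots> \<le> (C1 + C2) * S" using C S1 by (intro mult_right_mono) auto
    finally show "\<exists>N' L'. computes A N' L' (\<lambda>z. length xs \<le> 2 * count val xs z) \<and>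
      real N' \<le> (C1 + C2) * real (length xs) powr (2 / real r) * real N \<and>
      real L' \<le> (C1 + C2) * (\<Sum>l\<leftarrow>xs. real (len l) + 1)"
      using comp NN unfolding S_def by blast
  qed
qed

section \<open>Formulas with Majority gates\<close>

definition formulas :: "nat \<Rightarrow> bform set" where
  "formulas k = {F. (\<exists>n. formula_on n F) \<and> maj_depth F \<le> k}"

text \<open>The formulas that a skeleton treats as indivisible: constants, literals and Majority
  gates.\<close>

definition atoms :: "nat \<Rightarrow> bform set" where
  "atoms k = {F \<in> formulas k. \<forall>Fs. F \<noteq> And Fs \<and> F \<noteq> Or Fs \<and> F \<noteq> Xor Fs}"

section \<open>From gates of arbitrary fan-in to binary trees\<close>

lemma leaves_pos: "formula_on n F \<Longrightarrow> 1 \<le> leaves F"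
proof (induction F)
  have *: "1 \<le> (\<Sum>F\<leftarrow>Fs. leaves F)"
    if "\<And>F. F \<in> set Fs \<Longrightarrow> formula_on n F \<Longrightarrow> 1 \<le> leaves F" "Fs \<noteq> []" "\<forall>F\<in>set Fs. formula_on n F" for Fs
    using that by (cases Fs) (auto simp: trans_le_add1)
  { case And then show ?case using * by simp }
  { case Or then show ?case using * by simp }
  { case Xor then show ?case using * by simp }
  { case Maj then show ?case using * by simp }
qed auto

text \<open>The slack of 3 in the weight is kept by every binary operation: two operands bring a
  slack of 6, of which a disjunction spends 3 on constants.\<close>

definition tree_for :: "nat \<Rightarrow> (input \<Rightarrow> bool) \<Rightarrow> nat \<Rightarrow> bform tree \<Rightarrow> bool" where
  "tree_for k f s T \<longleftrightarrow> (\<forall>z. ev z T = f z) \<and> weight T + 3 \<le> 4 * s \<and>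
     set (labels T) \<subseteq> {l \<in> atoms k. leaves l \<le> s}"

lemma Const_atoms: "Const b \<in> atoms k"
  unfolding atoms_def formulas_def by simp

text \<open>The gate \<open>h\<close> is folded from the right by \<open>op\<close>, starting at the
  last input, so that no neutral element occurs.\<close>

lemma ex_tree_list:
  assumes "\<And>F. F \<in> set Fs \<Longrightarrow> \<exists>T. tree_for k (\<lambda>z. eval z F) (leaves F) T" "Fs \<noteq> []"
    and op: "\<And>f g s t S T. tree_for k f s S \<Longrightarrow> tree_for k g t T \<Longrightarrow> \<exists>U. tree_for k (\<lambda>z. op (f z) (g z)) (s + t) U"
    and fold: "\<And>z F. h z [F] = eval z F" "\<And>z F G Fs. h z (F # G # Fs) = op (eval z F) (h z (G # Fs))"
  shows "\<exists>T. tree_for k (\<lambda>z. h z Fs) (\<Sum>F\<leftarrow>Fs. leaves F) T"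
  using assms(2,1)
proof (induction Fs rule: list_nonempty_induct)
  case (single F)
  then show ?case by (simp add: fold)
next
  case (cons F Fs)
  obtain S where S: "tree_for k (\<lambda>z. eval z F) (leaves F) S" using cons.prems by auto
  obtain T where T: "tree_for k (\<lambda>z. h z Fs) (\<Sum>F\<leftarrow>Fs. leaves F) T" using cons by auto
  obtain G Gs where "Fs = G # Gs" using cons.hyps by (cases Fs) auto
  then show ?case using op[OF S T] by (simp add: fold)
qed

lemma tree_for_Conj:
  "tree_for k f s S \<Longrightarrow> tree_for k g t T \<Longrightarrow> \<exists>U. tree_for k (\<lambda>z. f z \<and> g z) (s + t) U"
  by (rule exI[of _ "Conj S T"]) (auto simp: tree_for_def)

lemma tree_for_Plus:
  "tree_for k f s S \<Longrightarrow> tree_for k g t T \<Longrightarrow> \<exists>U. tree_for k (\<lambda>z. f z \<noteq> g z) (s + t) U"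
  by (rule exI[of _ "Plus S T"]) (auto simp: tree_for_def)

text \<open>De Morgan's law, with negation as addition of the constant true; each operand still
  occurs only once.\<close>

lemma tree_for_Disj:
  assumes "tree_for k f s S" "tree_for k g t T"
  shows "\<exists>U. tree_for k (\<lambda>z. f z \<or> g z) (s + t) U"
proof -
  let ?neg = "\<lambda>T. Plus (Leaf (Const True)) T"
  have "tree_for k (\<lambda>z. f z \<or> g z) (s + t) (?neg (Conj (?neg S) (?neg T)))"
    using assms Const_atoms[of True k] by (auto simp: tree_for_def)
  then show ?thesis by blast
qed

lemma formulas_list:
  assumes "F \<in> set Fs" "Max (maj_depth ` set Fs) \<le> k" "\<forall>F\<in>set Fs. formula_on n F"
  shows "F \<in> formulas k"
proof -
  have "maj_depth F \<le> Max (maj_depth ` set Fs)" using assms(1) by (intro Max_ge) auto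
  then have "maj_depth F \<le> k" using assms(2) by (rule order_trans)
  then show ?thesis unfolding formulas_def using assms by auto
qed

lemma ex_tree: "F \<in> formulas k \<Longrightarrow> \<exists>T. tree_for k (\<lambda>z. eval z F) (leaves F) T"
proof (induction F)
  have leaf: "\<exists>T. tree_for k (\<lambda>z. eval z F) (leaves F) T" if "F \<in> atoms k" for F
  proof -
    have "1 \<le> leaves F" using that leaves_pos unfolding atoms_def formulas_def by blast
    then show ?thesis using that by (intro exI[of _ "Leaf F"]) (simp add: tree_for_def)
  qed
  { case (Const b) then show ?case using leaf[of "Const b"] by (simp add: atoms_def) }
  { case (Var i) then show ?case using leaf[of "Var i"] by (simp add: atoms_def) }
  { case (NegVar i) then show ?case using leaf[of "NegVar i"] by (simp add: atoms_def) }
  { case (Maj Fs) then show ?case using leaf[of "Maj Fs"] by (simp add: atoms_def) }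
  { case (And Fs)
    then have ne: "Fs \<noteq> []" and F: "\<And>F. F \<in> set Fs \<Longrightarrow> F \<in> formulas k"
      using formulas_list[of _ Fs k] by (auto simp: formulas_def)
    show ?case
      using ex_tree_list[OF And.IH[OF _ F] ne tree_for_Conj, where h = "\<lambda>z Fs. eval z (And Fs)"] by simp }
  { case (Or Fs)
    then have ne: "Fs \<noteq> []" and F: "\<And>F. F \<in> set Fs \<Longrightarrow> F \<in> formulas k"
      using formulas_list[of _ Fs k] by (auto simp: formulas_def)
    show ?case
      using ex_tree_list[OF Or.IH[OF _ F] ne tree_for_Disj, where h = "\<lambda>z Fs. eval z (Or Fs)"] by simp }
  { case (Xor Fs)
    then have ne: "Fs \<noteq> []" and F: "\<And>F. F \<in> set Fs \<Longrightarrow> F \<in> formulas k"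
      using formulas_list[of _ Fs k] by (auto simp: formulas_def)
    show ?case
      using ex_tree_list[OF Xor.IH[OF _ F] ne tree_for_Plus, where h = "\<lambda>z Fs. eval z (Xor Fs)"] by simp }
qed

text \<open>The width may depend on any bound \<open>s\<close> on the number of leaves, so that
  several formulas can be given a common width.\<close>

definition bounded :: "bform set \<Rightarrow> real \<Rightarrow> real \<Rightarrow> bool" where
  "bounded \<F> \<epsilon> C \<longleftrightarrow> (\<forall>A s. \<forall>F\<in>\<F>. leaves F \<le> s \<longrightarrow>
     (\<exists>L. computes A (nat \<lfloor>C * real s powr \<epsilon>\<rfloor>) L (\<lambda>z. eval z F) \<and>
       real L \<le> C * real (leaves F) powr (1 + \<epsilon>)))"

lemma boundedD:
  assumes "bounded \<F> \<epsilon> C"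
  shows "\<exists>len. \<forall>F\<in>\<F>. leaves F \<le> s \<longrightarrow> computes A (nat \<lfloor>C * real s powr \<epsilon>\<rfloor>) (len F) (\<lambda>z. eval z F) \<and>
    real (len F) \<le> C * real (leaves F) powr (1 + \<epsilon>)"
  using assms unfolding bounded_def by metis

section \<open>Width and length bounds by induction on the nesting of Majority gates\<close>

lemma leaves_formulas: "F \<in> formulas k \<Longrightarrow> 1 \<le> leaves F"
  unfolding formulas_def using leaves_pos by blast

text \<open>The recursive evaluation multiplies the width by \<open>2 ^ R\<close>, where
  \<open>R\<close> depends on \<open>\<epsilon>\<close> alone, and the length by a constant, so the
  exponent is the same for atoms and for formulas above them.\<close>

lemma bounded_formulas:
  assumes \<epsilon>: "0 < \<epsilon>" and C: "1 \<le> C" and b: "bounded (atoms k) \<epsilon> C"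
  shows "\<exists>C'\<ge>1. bounded (formulas k) \<epsilon> C'"
proof -
  define K where "K = max 3 (nat \<lceil>2 * 64 powr (1 / \<epsilon>)\<rceil>)"
  have K3: "3 \<le> K" by (simp add: K_def)
  have "2 * 64 powr (1 / \<epsilon>) \<le> real K" unfolding K_def by linarith
  then have "2 / real K \<le> 1 / 64 powr (1 / \<epsilon>)" using K3 by (simp add: field_simps)
  then have "(2 / real K) powr \<epsilon> \<le> (1 / 64 powr (1 / \<epsilon>)) powr \<epsilon>" using \<epsilon> by (intro powr_mono2) auto
  also have "\<dots> = 1 / 64" using \<epsilon> by (simp add: powr_divide powr_powr)
  finally have K: "(2 / real K) powr \<epsilon> \<le> 1 / 64" .
  define R where "R = 12 * K + 3"
  \<comment> \<open>228 is 76 times 3, the 3 coming from the \<open>2 * len + 1\<close> steps of a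
    controlled addition. The tree has up to four times the weight of the formula, and the final 1
    allows for rounding up.\<close>
  define C1 where "C1 = 228 * C * 4 powr (1 + \<epsilon>) + 1"
  have C1: "0 \<le> C1" using C by (simp add: C1_def)
  show ?thesis
  proof (intro exI[of _ "2 ^ R * C + C1"] conjI)
    show "1 \<le> 2 ^ R * C + C1" using C C1 mult_mono[of 1 "2 ^ R" 1 C] by simp
    show "bounded (formulas k) \<epsilon> (2 ^ R * C + C1)"
      unfolding bounded_def
    proof (intro allI ballI impI)
      fix A s F assume F: "F \<in> formulas k" "leaves F \<le> s"
      define N where "N = nat \<lfloor>C * real s powr \<epsilon>\<rfloor>"
      define G where "G = {l \<in> atoms k. leaves l \<le> s}"
      obtain len where len: "\<And>l. l \<in> G \<Longrightarrow> computes A N (len l) (\<lambda>z. eval z l)"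
        "\<And>l. l \<in> G \<Longrightarrow> real (len l) \<le> C * real (leaves l) powr (1 + \<epsilon>)"
        using boundedD[OF b, of s A] unfolding G_def N_def by blast
      obtain T where T: "\<And>z. ev z T = eval z F" "weight T + 3 \<le> 4 * leaves F"
        "set (labels T) \<subseteq> {l \<in> atoms k. leaves l \<le> leaves F}"
        using ex_tree[OF F(1)] unfolding tree_for_def by blast
      have F1: "1 \<le> leaves F" using F(1) by (rule leaves_formulas)
      have G: "Const b \<in> G" for b using Const_atoms F1 F(2) by (simp add: G_def)
      have G1: "1 \<le> leaves l" if "l \<in> G" for l
        using that leaves_formulas unfolding G_def atoms_def by blast
      have N2: "2 \<le> N" using len(1)[OF G[of True]] unfolding computes_def by simp
      define c where "c l = real (2 * len l + 1)" for l
      have c: "c l \<le> 3 * C * real (leaves l) powr (1 + \<epsilon>)" if "l \<in> G" for l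
      proof -
        have "1 \<le> real (leaves l) powr (1 + \<epsilon>)" using G1[OF that] \<epsilon> by (intro ge_one_powr_ge_zero) auto
        then have "1 * 1 \<le> C * real (leaves l) powr (1 + \<epsilon>)" using C by (intro mult_mono) auto
        then show ?thesis using len(2)[OF that] by (simp add: c_def)
      qed
      define x where "x = 76 * (3 * C) * real (weight T) powr (1 + \<epsilon>)"
      have "set (labels T) \<subseteq> G" using T(3) F(2) unfolding G_def by auto
      then have "implements R (\<lambda>l z. eval z l) c G (\<lambda>z. ev z T) x"
        unfolding x_def using C by (intro implements_ev[OF \<epsilon> K3 K _ G G G1 _ c]) (auto simp: R_def)
      then have comp: "computes A (2 ^ R * N) (nat \<lceil>x\<rceil>) (\<lambda>z. eval z F)"
        unfolding T(1) using len(1) N2 K3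
        by (intro computes_implements[where val = "\<lambda>l z. eval z l" and c = c and len = len and G = G])
          (auto simp: R_def c_def of_nat_ceiling)
      have "real (2 ^ R * N) \<le> 2 ^ R * (C * real s powr \<epsilon>)"
        using C unfolding N_def by (simp add: mult_left_mono)
      also have "\<dots> \<le> (2 ^ R * C + C1) * real s powr \<epsilon>" using C1 by (simp add: algebra_simps)
      finally have N': "2 ^ R * N \<le> nat \<lfloor>(2 ^ R * C + C1) * real s powr \<epsilon>\<rfloor>" by (rule le_nat_floor)
      have F1': "1 \<le> real (leaves F) powr (1 + \<epsilon>)" using F1 \<epsilon> by (intro ge_one_powr_ge_zero) auto
      have "real (weight T) powr (1 + \<epsilon>) \<le> (4 * real (leaves F)) powr (1 + \<epsilon>)"
        using T(2) \<epsilon> by (intro powr_mono2) auto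
      also have "\<dots> = 4 powr (1 + \<epsilon>) * real (leaves F) powr (1 + \<epsilon>)" by (simp add: powr_mult)
      finally have "x \<le> 228 * C * (4 powr (1 + \<epsilon>) * real (leaves F) powr (1 + \<epsilon>))"
        unfolding x_def using C by (simp add: mult_left_mono)
      then have x: "x + 1 \<le> C1 * real (leaves F) powr (1 + \<epsilon>)"
        using F1' unfolding C1_def by (simp add: algebra_simps)
      have "0 \<le> x" using C by (simp add: x_def)
      then have "real (nat \<lceil>x\<rceil>) \<le> x + 1" by linarith
      also note x
      also have "C1 * real (leaves F) powr (1 + \<epsilon>) \<le> (2 ^ R * C + C1) * real (leaves F) powr (1 + \<epsilon>)"
        using C by (intro mult_right_mono) auto
      finally show "\<exists>L. computes A (nat \<lfloor>(2 ^ R * C + C1) * real s powr \<epsilon>\<rfloor>) L (\<lambda>z. eval z F) \<and>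
          real L \<le> (2 ^ R * C + C1) * real (leaves F) powr (1 + \<epsilon>)"
        using computes_mono[OF comp N' order_refl] by blast
    qed
  qed
qed

lemma computes_literal:
  assumes "2 \<le> N" "F = Const b \<or> F = Var i \<or> F = NegVar i"
  shows "computes A N 1 (\<lambda>z. eval z F)"
  using assms(2) computes_const[OF assms(1), of A b] computes_var[OF assms(1), of A i False]
    computes_var[OF assms(1), of A i True] by auto

lemma bounded_atoms_0: "0 < \<epsilon> \<Longrightarrow> bounded (atoms 0) \<epsilon> 2"
  unfolding bounded_def
proof (intro allI ballI impI)
  fix A s F assume \<epsilon>: "0 < \<epsilon>" and F: "F \<in> atoms 0" "leaves F \<le> s"
  have lit: "\<exists>b i. F = Const b \<or> F = Var i \<or> F = NegVar i"
    using F(1) by (cases F) (auto simp: atoms_def formulas_def)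
  have "1 \<le> s" using lit F(2) by auto
  then have "1 \<le> real s powr \<epsilon>" using \<epsilon> by (intro ge_one_powr_ge_zero) auto
  then have "2 \<le> nat \<lfloor>2 * real s powr \<epsilon>\<rfloor>" by (intro le_nat_floor) simp
  then have "computes A (nat \<lfloor>2 * real s powr \<epsilon>\<rfloor>) 1 (\<lambda>z. eval z F)"
    using lit computes_literal by blast
  moreover have "leaves F = 1" using lit by auto
  ultimately show "\<exists>L. computes A (nat \<lfloor>2 * real s powr \<epsilon>\<rfloor>) L (\<lambda>z. eval z F) \<and>
      real L \<le> 2 * real (leaves F) powr (1 + \<epsilon>)" by (intro exI[of _ 1]) auto
qed

text \<open>The gate multiplies the width of its inputs by \<open>m powr (2 / r)\<close> up to a
  constant, which is at most \<open>s powr \<epsilon>\<close> once \<open>r\<close> reaches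
  \<open>2 / \<epsilon>\<close>; hence the doubled exponent. The lengths of the inputs add up
  properly because each of their leaves accounts for at most a constant times
  \<open>leaves F powr \<epsilon>\<close> steps.\<close>

lemma bounded_atoms_Suc:
  assumes \<epsilon>: "0 < \<epsilon>" and C: "1 \<le> C" and b: "bounded (formulas k) \<epsilon> C"
  shows "\<exists>C'\<ge>1. bounded (atoms (Suc k)) (2 * \<epsilon>) C'"
proof -
  define r where "r = nat \<lceil>2 / \<epsilon>\<rceil>"
  have "0 < 2 / \<epsilon>" using \<epsilon> by simp
  then have r: "1 \<le> r" "2 / \<epsilon> \<le> real r" unfolding r_def by linarith+
  then have r2: "2 / real r \<le> \<epsilon>" using \<epsilon> by (simp add: field_simps)
  from computes_majority[where 'l = bform, OF r(1)] obtain D where D: "0 \<le> D"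
    "\<And>A N xs (val :: bform \<Rightarrow> input \<Rightarrow> bool) len. xs \<noteq> [] \<Longrightarrow> 2 \<le> N \<Longrightarrow>
      \<forall>l\<in>set xs. computes A N (len l) (val l) \<Longrightarrow>
      \<exists>N' L'. computes A N' L' (\<lambda>z. length xs \<le> 2 * count val xs z) \<and>
        real N' \<le> D * real (length xs) powr (2 / real r) * real N \<and>
        real L' \<le> D * (\<Sum>l\<leftarrow>xs. real (len l) + 1)"
    by blast
  define C' where "C' = 2 + 2 * D * C"
  have C': "2 \<le> C'" "D * C \<le> C'" "2 * D * C \<le> C'" using D(1) C by (simp_all add: C'_def)
  show ?thesis
  proof (intro exI[of _ C'] conjI)
    show "1 \<le> C'" using C' by simp
    show "bounded (atoms (Suc k)) (2 * \<epsilon>) C'"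
      unfolding bounded_def
    proof (intro allI ballI impI)
      fix A s F assume F: "F \<in> atoms (Suc k)" "leaves F \<le> s"
      have F1: "1 \<le> leaves F" using F(1) leaves_formulas unfolding atoms_def by blast
      have s1: "1 \<le> real s powr (2 * \<epsilon>)" using \<epsilon> F1 F(2) by (intro ge_one_powr_ge_zero) auto
      have F1': "1 \<le> real (leaves F) powr (1 + 2 * \<epsilon>)" using F1 \<epsilon> by (intro ge_one_powr_ge_zero) auto
      show "\<exists>L. computes A (nat \<lfloor>C' * real s powr (2 * \<epsilon>)\<rfloor>) L (\<lambda>z. eval z F) \<and>
          real L \<le> C' * real (leaves F) powr (1 + 2 * \<epsilon>)"
      proof (cases "\<exists>b i. F = Const b \<or> F = Var i \<or> F = NegVar i")
        case True
        have "2 * 1 \<le> C' * real s powr (2 * \<epsilon>)" using C' s1 by (intro mult_mono) auto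
        then have "2 \<le> nat \<lfloor>C' * real s powr (2 * \<epsilon>)\<rfloor>" by (intro le_nat_floor) simp
        then have "computes A (nat \<lfloor>C' * real s powr (2 * \<epsilon>)\<rfloor>) 1 (\<lambda>z. eval z F)"
          using True computes_literal by blast
        moreover have "1 * 1 \<le> C' * real (leaves F) powr (1 + 2 * \<epsilon>)"
          using C' F1' by (intro mult_mono) auto
        ultimately show ?thesis by (intro exI[of _ 1]) simp
      next
        case False
        then obtain Fs where Fs: "F = Maj Fs" using F(1) by (cases F) (auto simp: atoms_def)
        obtain n where n: "Fs \<noteq> []" "\<forall>G\<in>set Fs. formula_on n G" "Max (maj_depth ` set Fs) \<le> k"
          using F(1) unfolding Fs atoms_def formulas_def by auto
        have G: "G \<in> formulas k" if "G \<in> set Fs" for G using formulas_list[OF that n(3,2)] .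
        have leF: "leaves G \<le> leaves F" if "G \<in> set Fs" for G
          unfolding Fs leaves.simps by (rule member_le_sum_list) (use that in auto)
        define N where "N = nat \<lfloor>C * real s powr \<epsilon>\<rfloor>"
        obtain len where len: "\<And>G. G \<in> set Fs \<Longrightarrow> computes A N (len G) (\<lambda>z. eval z G)"
          "\<And>G. G \<in> set Fs \<Longrightarrow> real (len G) \<le> C * real (leaves G) powr (1 + \<epsilon>)"
          using boundedD[OF b, of s A] G leF F(2) unfolding N_def by (metis order_trans)
        have "2 \<le> N" using len(1)[of "hd Fs"] n(1) unfolding computes_def by simp
        from D(2)[of Fs N A len "\<lambda>G z. eval z G", OF n(1) this] len(1)
        obtain N' L' where M: "computes A N' L' (\<lambda>z. length Fs \<le> 2 * count (\<lambda>G z. eval z G) Fs z)"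
          "real N' \<le> D * real (length Fs) powr (2 / real r) * real N"
          "real L' \<le> D * (\<Sum>G\<leftarrow>Fs. real (len G) + 1)" by blast
        have "(\<lambda>z. length Fs \<le> 2 * count (\<lambda>G z. eval z G) Fs z) = (\<lambda>z. eval z F)"
          unfolding Fs by (rule ext) (auto simp: count_def field_simps)
        then have comp: "computes A N' L' (\<lambda>z. eval z F)" using M(1) by simp
        have "(\<Sum>G\<leftarrow>Fs. 1) \<le> (\<Sum>G\<leftarrow>Fs. leaves G)" using G leaves_formulas by (intro sum_list_mono) blast
        then have lenF: "length Fs \<le> leaves F" unfolding Fs by (simp add: sum_list_triv)
        have ls: "1 \<le> real (length Fs)" "real (length Fs) \<le> real s"
          using n(1) lenF F(2) by (auto simp: Suc_le_eq)
        have "real (length Fs) powr (2 / real r) \<le> real (length Fs) powr \<epsilon>"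
          using ls(1) r2 by (intro powr_mono) auto
        also have "\<dots> \<le> real s powr \<epsilon>" using ls \<epsilon> by (intro powr_mono2) auto
        finally have "D * real (length Fs) powr (2 / real r) * real N \<le> D * real s powr \<epsilon> * (C * real s powr \<epsilon>)"
          using D(1) C unfolding N_def by (intro mult_mono mult_left_mono) auto
        also have "\<dots> = D * C * real s powr (2 * \<epsilon>)" by (simp add: powr_add[symmetric])
        also have "\<dots> \<le> C' * real s powr (2 * \<epsilon>)" using C' by (intro mult_right_mono) auto
        finally have "real N' \<le> C' * real s powr (2 * \<epsilon>)" using M(2) by linarith
        then have N': "N' \<le> nat \<lfloor>C' * real s powr (2 * \<epsilon>)\<rfloor>" by (rule le_nat_floor)
        have "real (len H) + 1 \<le> 2 * C * real (leaves F) powr \<epsilon> * real (leaves H)" if H: "H \<in> set Fs" for H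
        proof -
          have H1: "1 \<le> leaves H" using G[OF H] by (rule leaves_formulas)
          have "real (leaves H) powr (1 + \<epsilon>) \<le> real (leaves H) * real (leaves F) powr \<epsilon>"
            unfolding powr_one_plus[OF of_nat_0_le_iff]
            using leF[OF H] \<epsilon> by (intro mult_left_mono powr_mono2) auto
          then have "C * real (leaves H) powr (1 + \<epsilon>) \<le> C * (real (leaves H) * real (leaves F) powr \<epsilon>)"
            using C by (intro mult_left_mono) auto
          moreover have "1 * 1 \<le> C * real (leaves H) powr (1 + \<epsilon>)"
            using C H1 \<epsilon> by (intro mult_mono ge_one_powr_ge_zero) auto
          ultimately show ?thesis using len(2)[OF H] by (simp add: mult_ac)
        qed
        then have "(\<Sum>G\<leftarrow>Fs. real (len G) + 1) \<le> (\<Sum>H\<leftarrow>Fs. 2 * C * real (leaves F) powr \<epsilon> * real (leaves H))"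
          by (intro sum_list_mono) blast
        also have "\<dots> = 2 * C * real (leaves F) powr (1 + \<epsilon>)"
          unfolding powr_one_plus[OF of_nat_0_le_iff] Fs
          by (simp add: sum_list_const_mult of_nat_sum_list_map comp_def)
        finally have "D * (\<Sum>G\<leftarrow>Fs. real (len G) + 1) \<le> D * (2 * C * real (leaves F) powr (1 + \<epsilon>))"
          using D(1) by (rule mult_left_mono)
        also have "\<dots> \<le> D * (2 * C * real (leaves F) powr (1 + 2 * \<epsilon>))"
          using D(1) C F1 \<epsilon> by (intro mult_left_mono powr_mono) auto
        also have "\<dots> \<le> C' * real (leaves F) powr (1 + 2 * \<epsilon>)"
          using mult_right_mono[OF C'(3), of "real (leaves F) powr (1 + 2 * \<epsilon>)"] by (simp add: mult_ac)
        finally have "real L' \<le> C' * real (leaves F) powr (1 + 2 * \<epsilon>)" using M(3) by linarith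
        then show ?thesis using computes_mono[OF comp N' order_refl] by blast
      qed
    qed
  qed
qed

text \<open>Each level of Majority gates doubles the exponent, so the induction hypothesis is used
  with half of it. The constant depends on \<open>k\<close> and \<open>\<epsilon>\<close>.\<close>

lemma ex_bounded_formulas: "0 < \<epsilon> \<Longrightarrow> \<exists>C\<ge>1. bounded (formulas k) \<epsilon> C"
proof (induction k arbitrary: \<epsilon>)
  case 0
  then show ?case using bounded_formulas[OF _ _ bounded_atoms_0] by simp
next
  case (Suc k)
  then obtain C where "1 \<le> C" "bounded (formulas k) (\<epsilon> / 2) C" using half_gt_zero by blast
  then obtain C' where "1 \<le> C'" "bounded (atoms (Suc k)) \<epsilon> C'"
    using bounded_atoms_Suc[of "\<epsilon> / 2" C k] Suc.prems by auto
  then show ?case using bounded_formulas Suc.prems by blast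
qed

theorem theorem5:
  fixes k :: nat and \<epsilon> :: real
  assumes "\<epsilon> > 0"
  shows "\<exists>C::real. \<forall>(n::nat) (A::nat set) (F::bform) (g::(nat \<Rightarrow> bool) \<Rightarrow> bool).
    A \<subseteq> {..<n} \<longrightarrow> formula_on n F \<longrightarrow> maj_depth F \<le> k \<longrightarrow> formula_computes n F g \<longrightarrow>
    ereal_of_enat (GH (cube A) (cube ({..<n} - A)) (split_fun A g))
      \<le> ereal (C * real (leaves F) powr (1 + \<epsilon>))"
proof -
  \<comment> \<open>The number of pipes is about the product of width and length, each of which
    contributes one \<open>\<delta>\<close> to the exponent.\<close>
  define \<delta> where "\<delta> = \<epsilon> / 2"
  have \<delta>: "0 < \<delta>" using assms by (simp add: \<delta>_def)
  then obtain C where C: "1 \<le> C" "bounded (formulas k) \<delta> C" using ex_bounded_formulas by blast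
  show ?thesis
  proof (intro exI[of _ "3 * C * C + 1"] allI impI)
    fix n A F and g :: "(nat \<Rightarrow> bool) \<Rightarrow> bool"
    assume A: "A \<subseteq> {..<n}" and F: "formula_on n F" "maj_depth F \<le> k" and g: "formula_computes n F g"
    define s where "s = real (leaves F)"
    have s: "1 \<le> s" using leaves_pos[OF F(1)] by (simp add: s_def)
    have "F \<in> formulas k" using F unfolding formulas_def by blast
    then obtain L where L: "computes A (nat \<lfloor>C * s powr \<delta>\<rfloor>) L (\<lambda>z. eval z F)" "real L \<le> C * s powr (1 + \<delta>)"
      using C(2) unfolding bounded_def s_def by blast
    define N where "N = nat \<lfloor>C * s powr \<delta>\<rfloor>"
    have N: "real N \<le> C * s powr \<delta>" using C(1) unfolding N_def by simp
    have p: "1 \<le> s powr \<delta>" "1 \<le> s powr (1 + \<delta>)" "1 \<le> s powr (1 + \<epsilon>)"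
      using s \<delta> assms by (simp_all add: ge_one_powr_ge_zero)
    have "1 * 1 \<le> C * s powr (1 + \<delta>)" using C(1) p by (intro mult_mono) auto
    then have "2 * real L + 1 \<le> 3 * (C * s powr (1 + \<delta>))" using L(2) by linarith
    then have "real N * (2 * real L + 1) \<le> (C * s powr \<delta>) * (3 * (C * s powr (1 + \<delta>)))"
      using N C(1) by (intro mult_mono) auto
    also have "\<dots> = 3 * C * C * s powr (1 + \<epsilon>)"
      by (simp add: powr_add[symmetric] \<delta>_def add_ac)
    finally have "real (N * (2 * L + 1) + 1) \<le> 3 * C * C * s powr (1 + \<epsilon>) + 1" by (simp add: algebra_simps)
    also have "\<dots> \<le> (3 * C * C + 1) * s powr (1 + \<epsilon>)" using p(3) by (simp add: algebra_simps)
    finally have size: "real (N * (2 * L + 1) + 1) \<le> (3 * C * C + 1) * s powr (1 + \<epsilon>)" .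
    have "g z = eval z F" if "z \<in> cube {..<n}" for z using g that unfolding formula_computes_def by simp
    from GH_le_computes[OF A L(1)[folded N_def] this]
    have "ereal_of_enat (GH (cube A) (cube ({..<n} - A)) (split_fun A g)) \<le> ereal_of_enat (enat (N * (2 * L + 1) + 1))"
      unfolding ereal_of_enat_le_iff .
    also have "\<dots> = ereal (real (N * (2 * L + 1) + 1))" by simp
    also have "\<dots> \<le> ereal ((3 * C * C + 1) * real (leaves F) powr (1 + \<epsilon>))"
      using size unfolding s_def by simp
    finally show "ereal_of_enat (GH (cube A) (cube ({..<n} - A)) (split_fun A g))
        \<le> ereal ((3 * C * C + 1) * real (leaves F) powr (1 + \<epsilon>))" .
  qed
qed

end
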